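(* Let $F : (-\rho,\rho) \to \mathbb{R}$, where $0 < \rho \leq \infty$. The following are equivalent. (1) $F[-]$ maps the sequences $\bigcup_{u \in (0,1)} \mathcal{M}^\rho(\{-1,u,1\})$ into $\mathcal{M}(\mathbb{R})$. (2) $F[-]$ maps the sequences $\bigcup_{u \in (0,1)} \mathcal{M}^\rho(\{-1,u,1\})$ into $\mathcal{M}([-1,1])$. (3) $F[-]$ maps $\mathcal{M}^\rho([-1,1])$ into $\mathcal{M}(\mathbb{R})$. (4) $F$ is the restriction to $(-\rho,\rho)$ of an absolutely monotonic entire function.
   Context: An admissible measure is a non-negative measure $\mu$ on $\mathbb{R}$ possessing moments of all orders; its moments are $s_k(\mu) := \int_{\mathbb{R}} x^k \, d\mu$ ($k \geq 0$), where $s_0(\mu)$ is the total mass. For $K \subset \mathbb{R}$, $\mathcal{M}(K)$ denotes the set of moment sequences $(s_k(\mu))_{k \geq 0}$ of admissible measures $\mu$ supported on $K$, and $\mathcal{M}^\rho(K)$ is the subset of those sequences all of whose terms lie in $(-\rho,\rho)$ (so $\mathcal{M}^\infty(K) = \mathcal{M}(K)$). A function $F$ acts entrywise on a sequence by $F[(s_k)_{k\geq 0}] := (F(s_k))_{k \geq 0}$. An absolutely monotonic entire function is an entire function with non-negative Taylor coefficients at every point of $(0,\infty)$; equivalently, an entire function with non-negative Taylor coefficients at zero.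
   Formalization: For finite ρ, "entire" in (4) is replaced by "holomorphic on the disc |z|<ρ" with non-negative Taylor coefficients on (0,ρ): as stated the claim fails, since for ρ=1 the function 1/(1-x) satisfies (1)-(3) but is not entire. For ρ=∞ nothing is changed. *)

theory Defs
  imports "HOL-Complex_Analysis.Complex_Analysis"
begin

definition admissible_measure :: "real measure \<Rightarrow> bool" where
  "admissible_measure M \<longleftrightarrow> sets M = sets borel \<and> (\<forall>k::nat. integrable M (\<lambda>x. x ^ k))"

definition moment :: "real measure \<Rightarrow> nat \<Rightarrow> real" where
  "moment M k = (\<integral>x. x ^ k \<partial>M)"

(* For closed K, the almost-everywhere condition says that the topological
   support of M is contained in K. *)
definition moment_sequences :: "real set \<Rightarrow> (nat \<Rightarrow> real) set" where
  "moment_sequences K = {moment M |M. admissible_measure M \<and> (AE x in M. x \<in> K)}"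

definition bounded_moment_sequences :: "ereal \<Rightarrow> real set \<Rightarrow> (nat \<Rightarrow> real) set" where
  "bounded_moment_sequences \<rho> K =
     {s \<in> moment_sequences K. \<forall>k. ereal (s k) \<in> {-\<rho><..<\<rho>}}"

(* Only the values of F on the interval in which the terms of s lie matter. *)
definition entrywise :: "(real \<Rightarrow> real) \<Rightarrow> (nat \<Rightarrow> real) \<Rightarrow> (nat \<Rightarrow> real)" where
  "entrywise F s = (\<lambda>k. F (s k))"

(* Non-negative Taylor coefficients at every point of (0,\<rho>), for a function
   holomorphic on the open disc of radius \<rho> about 0. For \<rho> = \<infinity> the disc is the
   whole plane and these are the absolutely monotonic entire functions. For
   finite \<rho> the function need not extend beyond the disc: 1/(1-z) on the unit
   disc is an example, and x \<mapsto> 1/(1-x) does preserve moment sequences on [-1,1]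
   with terms in (-1,1), although it is not the restriction of any entire function. *)
definition absolutely_monotonic_on_disc :: "ereal \<Rightarrow> (complex \<Rightarrow> complex) \<Rightarrow> bool" where
  "absolutely_monotonic_on_disc \<rho> f \<longleftrightarrow>
     f holomorphic_on eball 0 \<rho> \<and>
     (\<forall>x::real. 0 < x \<and> ereal x < \<rho> \<longrightarrow>
        (\<forall>n. (deriv ^^ n) f (of_real x) / fact n \<in> \<real>\<^sub>\<ge>\<^sub>0))"

lemma absolutely_monotonic_on_disc_infinity:
  "absolutely_monotonic_on_disc \<infinity> f \<longleftrightarrow>
     f holomorphic_on UNIV \<and>
     (\<forall>x>0. \<forall>n. (deriv ^^ n) f (complex_of_real x) / fact n \<in> \<real>\<^sub>\<ge>\<^sub>0)"
  by (simp add: absolutely_monotonic_on_disc_def)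

end

theory Submission
  imports Defs "HOL-Probability.Probability"
begin

text \<open>The easy implications rest on the stability of moment sequences. If
\<open>F x = \<Sum>n. a n * x ^ n\<close> with \<open>a n \<ge> 0\<close>, then \<open>F\<close> applied to the moments \<open>s k\<close> of a measure \<open>\<mu>\<close>
on \<open>[-1, 1]\<close> gives \<open>\<Sum>n. a n * s k ^ n\<close>. If \<open>\<mu>\<close> is normalized
to mass \<open>1\<close>, the powers \<open>s k ^ n\<close> are the moments of the law of a product of \<open>n\<close> independent variables
distributed like \<open>\<mu>\<close>, and countable mixtures of moment sequences on \<open>[-1, 1]\<close> are
moment sequences on \<open>[-1, 1]\<close> (\<open>power_series_preserves_moment_sequences\<close>). As the sequences of
measures on \<open>{-1, u, 1}\<close> belong to measures on \<open>[-1, 1]\<close>, everything else reduces to one claim: a function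
that preserves the moment sequences \<open>s k = a * (-1) ^ k + b * u ^ k + c\<close> is a power series with
non-negative coefficients.

\<^bold>\<open>A priori bounds.\<close> Masses at \<open>-1\<close> and \<open>1\<close> alone give sequences that alternate between two values
\<open>x\<close> and \<open>y\<close> with \<open>\<bar>y\<bar> \<le> x\<close>, and the Hankel matrix of size two yields \<open>\<bar>F y\<bar> \<le> F x\<close>. So \<open>F\<close> is
non-negative and nondecreasing on \<open>[0, \<rho>)\<close>, the even transformed moments are bounded, and the
representing measures live on \<open>[-1, 1]\<close>, where moments determine a measure.

\<^bold>\<open>Interpolating the moments.\<close> Fix \<open>a, b, c\<close> and \<open>r\<close> and let \<open>\<sigma>\<close> represent
\<open>F (a * (-1) ^ k + b * r ^ k + c)\<close>. For odd \<open>m\<close>, let \<open>\<tau>\<close> represent the same expression with the \<open>m\<close>-th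
root of \<open>r\<close> in place of \<open>r\<close>. The image of \<open>\<tau>\<close> under \<open>x \<mapsto> x ^ m\<close> has the moments of \<open>\<sigma>\<close>, hence
equals \<open>\<sigma>\<close>, so
\<open>F (a * (-1) ^ j + b * r powr (j / m) + c) = \<integral> (sgn y) ^ j * \<bar>y\<bar> powr (j / m) \<partial>\<sigma>\<close> (\<open>F_at_odd_root\<close>). The right-hand
side extends to a holomorphic function of the exponent in the right half plane
(\<open>integral_powr_holomorphic\<close>), and the fractions \<open>j / m\<close> of either parity of \<open>j\<close> are dense. Both halves
of the proof exploit this.

\<^bold>\<open>Positive arguments.\<close> With \<open>a = c = 0\<close> and even \<open>j\<close>, monotonicity of \<open>F\<close> extends the identity to all
real exponents. Hence \<open>F\<close> is real analytic on \<open>(0, \<rho>)\<close>. Testing the positive semidefinite Hankel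
matrix of \<open>F (c + b * u ^ k)\<close> against a polynomial that vanishes at \<open>1, u, \<dots>, u ^ (n - 1)\<close> isolates
the \<open>n\<close>-th Taylor coefficient at \<open>c\<close> as \<open>b\<close> tends to \<open>0\<close>, so all derivatives are non-negative
(\<open>higher_deriv_F_nonneg\<close>). Bernstein's theorem (\<open>power_series_if_derivatives_nonneg\<close>) gives
\<open>F x = f x\<close> on \<open>(0, \<rho>)\<close> for a power series \<open>f\<close> with non-negative coefficients.

\<^bold>\<open>Negative arguments.\<close> With \<open>c = 0\<close> and odd \<open>j\<close>, the points \<open>b * r powr q - a\<close> sweep an interval that
reaches from \<open>b - a\<close> down to \<open>-a\<close>. If \<open>F = f\<close> is known near its upper end, then the holomorphic function
of \<open>q\<close> above agrees with \<open>f (b * r powr q - a)\<close> for small \<open>q\<close>, hence everywhere, in particular at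
\<open>q = 1\<close> (\<open>F_extends_leftwards\<close>). Small steps of this kind carry \<open>F = f\<close> from \<open>(0, \<rho>)\<close> to \<open>(-\<rho>, \<rho>)\<close>.\<close>

section \<open>Measures on the interval from -1 to 1\<close>

lemma atomic_moment_sequence:
  assumes fin: "finite A" and w: "\<And>x. x \<in> A \<Longrightarrow> 0 \<le> w x"
  shows "(\<lambda>k. \<Sum>x\<in>A. w x * x ^ k) \<in> moment_sequences A"
proof -
  define P where "P = point_measure A (\<lambda>x. ennreal (w x))"
  define M where "M = distr P borel (\<lambda>x::real. x)"
  have meas: "(\<lambda>x. x) \<in> measurable P borel"
    by (simp add: P_def measurable_point_measure_eq1)
  have int: "integrable P f" for f :: "real \<Rightarrow> real"
    unfolding P_def by (rule integrable_point_measure_finite[OF fin])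
  have "admissible_measure M"
    unfolding admissible_measure_def M_def by (simp add: integrable_distr_eq[OF meas] int)
  moreover have "moment M k = (\<Sum>x\<in>A. w x * x ^ k)" for k
  proof -
    have "moment M k = (\<integral>x. x ^ k \<partial>P)"
      unfolding moment_def M_def by (rule integral_distr[OF meas]) simp
    then show ?thesis
      unfolding P_def using w by (simp add: lebesgue_integral_point_measure_finite[OF fin])
  qed
  then have "moment M = (\<lambda>k. \<Sum>x\<in>A. w x * x ^ k)" by blast
  moreover have "A \<in> sets borel"
    using fin by (simp add: finite_imp_closed)
  then have "AE x in M. x \<in> A"
    unfolding M_def
    by (subst AE_distr_iff[OF meas]) (auto simp: P_def point_measure_def AE_density AE_count_space)
  ultimately show ?thesis
    unfolding moment_sequences_def by (intro CollectI exI[of _ M]) simp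
qed

text \<open>Formally still a measure on the whole line, so that images under powers, products and mixtures stay
within one type of measure. The moment sequences on \<open>[-1, 1]\<close> are exactly those of such measures.\<close>

definition interval_measure :: "real measure \<Rightarrow> bool" where
  "interval_measure M \<longleftrightarrow> sets M = sets borel \<and> finite_measure M \<and> (AE x in M. \<bar>x\<bar> \<le> 1)"

lemma integrable_interval_measure:
  fixes f :: "real \<Rightarrow> 'b::{banach, second_countable_topology}"
  assumes M: "interval_measure M" and f: "f \<in> borel_measurable borel"
    and b: "\<And>x. \<bar>x\<bar> \<le> 1 \<Longrightarrow> norm (f x) \<le> B"
  shows "integrable M f"
proof -
  interpret finite_measure M using M by (simp add: interval_measure_def)
  have s: "sets M = sets borel" using M by (simp add: interval_measure_def)
  show ?thesis
  proof (rule integrable_const_bound[where B = B])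
    show "AE x in M. norm (f x) \<le> B"
      using M b unfolding interval_measure_def by (auto elim: eventually_mono)
    show "f \<in> borel_measurable M"
      using f measurable_cong_sets[OF s refl] by blast
  qed
qed

lemma integrable_continuous_interval_measure:
  fixes f :: "real \<Rightarrow> real"
  assumes M: "interval_measure M" and f: "continuous_on UNIV f"
  shows "integrable M f"
proof -
  have "compact (f ` {-1..1})"
    by (intro compact_continuous_image continuous_on_subset[OF f]) auto
  then obtain B where B: "\<And>x. x \<in> {-1..1} \<Longrightarrow> norm (f x) \<le> B"
    by (metis bounded_iff compact_imp_bounded imageI)
  show ?thesis
    by (rule integrable_interval_measure[OF M borel_measurable_continuous_onI[OF f], where B = B])
      (use B in \<open>simp add: abs_le_iff\<close>)
qed

lemma moment_sequences_interval_iff: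
  "s \<in> moment_sequences {-1..1} \<longleftrightarrow> (\<exists>M. interval_measure M \<and> moment M = s)"
proof
  assume "s \<in> moment_sequences {-1..1}"
  then obtain M where M: "admissible_measure M" "AE x in M. x \<in> {-1..1}" "s = moment M"
    unfolding moment_sequences_def by auto
  have "integrable M (\<lambda>x. x ^ 0)" using M(1) unfolding admissible_measure_def by blast
  then have "integrable M (\<lambda>x. 1::real)" by simp
  then have "emeasure M (space M) < \<infinity>"
    unfolding integrable_iff_bounded by simp
  then have "finite_measure M" by (intro finite_measureI) auto
  moreover have "AE x in M. \<bar>x\<bar> \<le> 1"
    using M(2) by (auto elim: eventually_mono)
  ultimately show "\<exists>M. interval_measure M \<and> moment M = s"
    using M unfolding interval_measure_def admissible_measure_def by auto
next
  assume "\<exists>M. interval_measure M \<and> moment M = s"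
  then obtain M where M: "interval_measure M" "moment M = s" by auto
  have "admissible_measure M"
    unfolding admissible_measure_def
    using M(1) by (auto intro!: integrable_continuous_interval_measure continuous_intros
        simp: interval_measure_def)
  moreover have "AE x in M. x \<in> {-1..1}"
    using M(1) unfolding interval_measure_def by (auto elim: eventually_mono)
  ultimately show "s \<in> moment_sequences {-1..1}"
    using M(2) unfolding moment_sequences_def by auto
qed

text \<open>By Markov's inequality a set \<open>{x. \<bar>x\<bar> \<ge> d}\<close> has mass at most \<open>C / d ^ (2 * k)\<close> for every \<open>k\<close>, which
tends to \<open>0\<close> as soon as \<open>d > 1\<close>.\<close>

lemma interval_measure_if_moments_bounded:
  assumes adm: "admissible_measure M" and b: "\<And>k. moment M (2 * k) \<le> C"
  shows "interval_measure M"
proof -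
  have s: "sets M = sets borel" and int: "\<And>k. integrable M (\<lambda>x. x ^ k)"
    using adm unfolding admissible_measure_def by auto
  have sp: "space M = UNIV" using sets_eq_imp_space_eq[OF s] by simp
  have "integrable M (\<lambda>x. 1::real)" using int[of 0] by simp
  then have "emeasure M (space M) < \<infinity>"
    unfolding integrable_iff_bounded by simp
  then interpret finite_measure M by (intro finite_measureI) auto
  have null: "AE x in M. \<bar>x\<bar> < d" if d: "1 < d" for d
  proof -
    define S where "S = {x. d \<le> \<bar>x\<bar>}"
    have S: "S \<in> sets M" unfolding s S_def by measurable
    have le: "measure M S \<le> C / (d\<^sup>2) ^ k" for k
    proof -
      have "measure M {x\<in>space M. x ^ (2*k) \<ge> d ^ (2*k)} \<le> (\<integral>x. x ^ (2*k) \<partial>M) / d ^ (2*k)"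
        using d by (intro integral_Markov_inequality_measure[where A = "{}"] int) (auto simp: power_mult)
      also have "\<dots> \<le> C / d ^ (2*k)"
        using b[of k] d by (intro divide_right_mono) (auto simp: moment_def)
      also have "\<dots> = C / (d\<^sup>2) ^ k" by (simp add: power_mult)
      also have "measure M S \<le> measure M {x\<in>space M. x ^ (2*k) \<ge> d ^ (2*k)}"
      proof (rule finite_measure_mono)
        show "S \<subseteq> {x\<in>space M. x ^ (2*k) \<ge> d ^ (2*k)}"
        proof
          fix x assume "x \<in> S"
          then have "d ^ (2*k) \<le> \<bar>x\<bar> ^ (2*k)" using d by (intro power_mono) (auto simp: S_def)
          then show "x \<in> {x\<in>space M. x ^ (2*k) \<ge> d ^ (2*k)}"
            by (simp add: sp power_mult)
        qed
        show "{x \<in> space M. d ^ (2 * k) \<le> x ^ (2 * k)} \<in> sets M"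
          unfolding s sp by measurable
      qed
      finally show ?thesis .
    qed
    have "1 < d\<^sup>2" using d by (simp add: one_less_power)
    then have "(\<lambda>k. C / (d\<^sup>2) ^ k) \<longlonglongrightarrow> 0"
      by (rule LIMSEQ_divide_realpow_zero)
    then have "measure M S \<le> 0"
      by (rule LIMSEQ_le_const) (use le in auto)
    then have "measure M S = 0" by (simp add: measure_le_0_iff)
    then have "emeasure M S = 0" by (simp add: emeasure_eq_measure)
    then have "S \<in> null_sets M" using S by auto
    then show ?thesis
      by (rule AE_I') (auto simp: S_def)
  qed
  have "AE x in M. \<forall>n. \<bar>x\<bar> < 1 + inverse (real (Suc n))"
    unfolding AE_all_countable by (intro allI null) auto
  then have "AE x in M. \<bar>x\<bar> \<le> 1"
  proof (eventually_elim)
    case (elim x)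
    have "(\<lambda>n. 1 + inverse (real (Suc n))) \<longlonglongrightarrow> 1 + 0"
      by (intro tendsto_intros LIMSEQ_inverse_real_of_nat)
    then have "\<bar>x\<bar> \<le> 1 + 0"
      by (rule LIMSEQ_le_const) (use elim in \<open>auto intro: less_imp_le\<close>)
    then show ?case by simp
  qed
  then show ?thesis
    unfolding interval_measure_def using s finite_measure_axioms by auto
qed

lemma integral_interval_measure_le:
  fixes f :: "real \<Rightarrow> real"
  assumes M: "interval_measure M" and "integrable M f"
    and "\<And>x. \<bar>x\<bar> \<le> 1 \<Longrightarrow> \<bar>f x\<bar> \<le> e"
  shows "\<bar>integral\<^sup>L M f\<bar> \<le> e * measure M (space M)"
proof -
  interpret finite_measure M using M by (simp add: interval_measure_def)
  have "\<bar>integral\<^sup>L M f\<bar> \<le> (\<integral>x. \<bar>f x\<bar> \<partial>M)" by simp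
  also have "\<dots> \<le> (\<integral>x. e \<partial>M)"
    using assms by (intro integral_mono_AE) (auto simp: interval_measure_def elim: eventually_mono)
  finally show ?thesis by (simp add: mult.commute)
qed

lemma integrable_power_interval_measure:
  "interval_measure M \<Longrightarrow> integrable M (\<lambda>x. x ^ k)"
  by (intro integrable_continuous_interval_measure continuous_intros)

lemma abs_moment_le_mass:
  assumes "interval_measure M"
  shows "\<bar>moment M k\<bar> \<le> measure M (space M)"
  using integral_interval_measure_le[OF assms integrable_power_interval_measure[OF assms], of k 1]
  by (simp add: moment_def power_abs power_le_one)

text \<open>The determinacy of the moment problem on a compact interval, in the form needed for extracting
roots: the hypothesis compares the moments of \<open>M\<close> with those of the image of \<open>N\<close> under the \<open>p\<close>-th power
map, and Weierstrass approximation passes from polynomials to continuous functions.\<close>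

lemma integral_eq_if_moments_eq:
  fixes \<phi> :: "real \<Rightarrow> real"
  assumes M: "interval_measure M" and N: "interval_measure N"
    and m: "\<And>k. moment N (p * k) = moment M k"
    and \<phi>: "continuous_on UNIV \<phi>"
  shows "(\<integral>x. \<phi> (x ^ p) \<partial>N) = (\<integral>x. \<phi> x \<partial>M)"
proof -
  let ?d = "(\<integral>x. \<phi> (x ^ p) \<partial>N) - (\<integral>x. \<phi> x \<partial>M)"
  let ?m = "measure N (space N) + measure M (space M)"
  have cp: "continuous_on UNIV (\<lambda>x. f (x ^ p))" if "continuous_on UNIV f" for f :: "real \<Rightarrow> real"
    by (rule continuous_on_compose2[OF that]) (auto intro!: continuous_intros)
  note iM = integrable_continuous_interval_measure[OF M]
  note iN = integrable_continuous_interval_measure[OF N]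
  have bd: "\<bar>?d\<bar> \<le> e * ?m" if e: "0 < e" for e
  proof -
    obtain q where q: "real_polynomial_function q" "\<forall>x\<in>{-1..1}. \<bar>\<phi> x - q x\<bar> < e"
      using Stone_Weierstrass_real_polynomial_function[of "{-1..1}" \<phi> e] continuous_on_subset[OF \<phi>] e
      by (metis compact_Icc subset_UNIV)
    have q2: "\<bar>\<phi> x - q x\<bar> \<le> e" if "\<bar>x\<bar> \<le> 1" for x
    proof -
      have "x \<in> {-1..1}" using that by auto
      then show ?thesis using q(2) by (blast intro: less_imp_le)
    qed
    obtain a n where an: "q = (\<lambda>x. \<Sum>i\<le>n. a i * x ^ i)"
      using q(1) unfolding real_polynomial_function_iff_sum by blast
    have cq: "continuous_on UNIV q" unfolding an by (intro continuous_intros)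
    have "(\<integral>x. q (x ^ p) \<partial>N) = (\<Sum>i\<le>n. a i * moment N (p * i))"
      unfolding an moment_def power_mult
      by (subst Bochner_Integration.integral_sum) (auto intro!: iN continuous_intros)
    also have "\<dots> = (\<integral>x. q x \<partial>M)"
      unfolding m unfolding an moment_def
      by (subst Bochner_Integration.integral_sum) (auto intro!: iM continuous_intros)
    finally have eq: "(\<integral>x. q (x ^ p) \<partial>N) = (\<integral>x. q x \<partial>M)" .
    have p1: "\<bar>x ^ p\<bar> \<le> 1" if "\<bar>x\<bar> \<le> 1" for x :: real
      using that by (simp add: power_abs power_le_one)
    have "?d = (\<integral>x. \<phi> (x ^ p) - q (x ^ p) \<partial>N) - (\<integral>x. \<phi> x - q x \<partial>M)"
      using eq by (simp add: Bochner_Integration.integral_diff iM iN cp \<phi> cq)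
    moreover have "\<bar>\<integral>x. \<phi> (x ^ p) - q (x ^ p) \<partial>N\<bar> \<le> e * measure N (space N)"
      by (intro integral_interval_measure_le[OF N] iN continuous_intros cp \<phi> cq q2 p1)
    moreover have "\<bar>\<integral>x. \<phi> x - q x \<partial>M\<bar> \<le> e * measure M (space M)"
      by (intro integral_interval_measure_le[OF M] iM continuous_intros \<phi> cq q2)
    ultimately show ?thesis by (simp add: algebra_simps)
  qed
  have "\<bar>?d\<bar> \<le> 0 + e" if e: "0 < e" for e
  proof -
    have m0: "0 \<le> ?m" by simp
    have "\<bar>?d\<bar> \<le> e / (?m + 1) * ?m" using e by (intro bd divide_pos_pos add_nonneg_pos[OF m0]) auto
    also have "\<dots> \<le> e"
    proof -
      have "e / (x + 1) * x \<le> e" if "0 \<le> x" for x using e that by (simp add: field_simps)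
      then show ?thesis using m0 by blast
    qed
    finally show ?thesis by simp
  qed
  then have "\<bar>?d\<bar> \<le> 0" by (rule field_le_epsilon)
  then show ?thesis by simp
qed

section \<open>Power moments with complex exponent\<close>

text \<open>Expand \<open>\<bar>y\<bar> powr w = \<bar>y\<bar> powr c * exp ((w - c) * ln \<bar>y\<bar>)\<close> in powers of \<open>w - c\<close> and integrate termwise.
The absolute values of the terms sum to at most \<open>\<bar>y\<bar> powr (c - norm (w - c))\<close>, which is bounded by \<open>1\<close>
on \<open>[-1, 1]\<close> because \<open>w\<close> lies in the disc of radius \<open>c\<close>. The weight \<open>g\<close> stands for \<open>1\<close> or for the
sign of \<open>y\<close>.\<close>

lemma integral_powr_power_series:
  fixes g :: "real \<Rightarrow> real" and c :: real and w :: complex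
  assumes M: "interval_measure M" and g: "g \<in> borel_measurable borel" "\<And>y. \<bar>g y\<bar> \<le> 1"
    and c: "0 < c"
  defines "a \<equiv> \<lambda>n. \<integral>y. g y * \<bar>y\<bar> powr c * ln \<bar>y\<bar> ^ n / fact n \<partial>M"
  assumes w: "norm (w - of_real c) < c"
  shows "(\<lambda>n. of_real (a n) * (w - of_real c) ^ n) sums
    (\<integral>y. of_real (g y) * (of_real \<bar>y\<bar> powr w) \<partial>M)"
proof -
  interpret finite_measure M using M by (simp add: interval_measure_def)
  have sM: "sets M = sets borel" using M by (simp add: interval_measure_def)
  define r where "r = norm (w - of_real c)"
  define t where "t n y = g y * \<bar>y\<bar> powr c * ln \<bar>y\<bar> ^ n / fact n" for n y
  define f where "f n y = complex_of_real (t n y) * (w - of_real c) ^ n" for n y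
  have tm: "t n \<in> borel_measurable borel" for n
    unfolding t_def using g(1) by measurable
  have nf: "norm (f n y) = \<bar>t n y\<bar> * r ^ n" for n y
    by (simp add: f_def r_def norm_mult norm_power)
  have dom: "(\<lambda>n. \<bar>y\<bar> powr c * ((r * - ln \<bar>y\<bar>) ^ n / fact n)) sums (\<bar>y\<bar> powr c * exp (r * - ln \<bar>y\<bar>))" for y
    using exp_converges[of "r * - ln \<bar>y\<bar>"] by (intro sums_mult) (simp add: field_simps scaleR_conv_of_real)
  have t_le: "norm (f n y) \<le> \<bar>y\<bar> powr c * ((r * - ln \<bar>y\<bar>) ^ n / fact n)" if "\<bar>y\<bar> \<le> 1" for n y
  proof (cases "y = 0")
    case False
    then have ln: "ln \<bar>y\<bar> \<le> 0" using that by simp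
    have "norm (f n y) = \<bar>g y\<bar> * (\<bar>y\<bar> powr c * ((r * - ln \<bar>y\<bar>) ^ n / fact n))"
    proof -
      have "(r * - ln \<bar>y\<bar>) ^ n = r ^ n * \<bar>ln \<bar>y\<bar>\<bar> ^ n"
        using ln by (simp only: power_mult_distrib abs_of_nonpos)
      then show ?thesis unfolding nf t_def by (simp add: abs_mult power_abs)
    qed
    also have "\<dots> \<le> 1 * (\<bar>y\<bar> powr c * ((r * - ln \<bar>y\<bar>) ^ n / fact n))"
      using ln by (intro mult_right_mono g(2) mult_nonneg_nonneg divide_nonneg_nonneg zero_le_power)
        (auto simp: r_def mult_nonneg_nonpos)
    finally show ?thesis by simp
  qed (auto simp: f_def t_def)
  have exp_le: "\<bar>y\<bar> powr c * exp (r * - ln \<bar>y\<bar>) \<le> 1" if "\<bar>y\<bar> \<le> 1" for y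
  proof (cases "y = 0")
    case False
    then have "\<bar>y\<bar> powr c * exp (r * - ln \<bar>y\<bar>) = exp ((c - r) * ln \<bar>y\<bar>)"
      by (simp add: powr_def exp_add[symmetric] algebra_simps)
    also have "\<dots> \<le> 1" using False that w
      by (simp add: r_def mult_nonneg_nonpos)
    finally show ?thesis .
  qed auto
  have psum: "(\<Sum>n<N. norm (f n y)) \<le> 1" if "\<bar>y\<bar> \<le> 1" for N y
  proof -
    have ln: "ln \<bar>y\<bar> \<le> 0" using that by (cases "y = 0") auto
    have "(\<Sum>n<N. norm (f n y)) \<le> (\<Sum>n<N. \<bar>y\<bar> powr c * ((r * - ln \<bar>y\<bar>) ^ n / fact n))"
      by (intro sum_mono t_le that)
    also have "\<dots> \<le> \<bar>y\<bar> powr c * exp (r * - ln \<bar>y\<bar>)"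
      unfolding sums_unique[OF dom]
      using ln by (intro sum_le_suminf sums_summable[OF dom])
        (auto intro!: mult_nonneg_nonneg divide_nonneg_nonneg zero_le_power simp: r_def mult_nonneg_nonpos)
    finally show ?thesis using exp_le[OF that] by simp
  qed
  have int: "integrable M (f n)" for n
  proof (rule integrable_interval_measure[OF M])
    show "f n \<in> borel_measurable borel" unfolding f_def using tm by measurable
    show "norm (f n y) \<le> 1" if "\<bar>y\<bar> \<le> 1" for y
      using psum[OF that, of "Suc n"] sum_nonneg[of "{..<n}" "\<lambda>n. norm (f n y)"] by simp
  qed
  have lim: "(\<lambda>n. f n y) sums (of_real (g y) * (of_real \<bar>y\<bar> powr w))" for y
  proof (cases "y = 0")
    case False
    have "(\<lambda>n. (of_real (ln \<bar>y\<bar>) * (w - of_real c)) ^ n /\<^sub>R fact n) sums exp (of_real (ln \<bar>y\<bar>) * (w - of_real c))"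
      by (rule exp_converges)
    then have "(\<lambda>n. of_real (g y * \<bar>y\<bar> powr c) * ((of_real (ln \<bar>y\<bar>) * (w - of_real c)) ^ n /\<^sub>R fact n)) sums
       (of_real (g y * \<bar>y\<bar> powr c) * exp (of_real (ln \<bar>y\<bar>) * (w - of_real c)))"
      by (rule sums_mult)
    also have "(\<lambda>n. of_real (g y * \<bar>y\<bar> powr c) * ((of_real (ln \<bar>y\<bar>) * (w - of_real c)) ^ n /\<^sub>R fact n)) = (\<lambda>n. f n y)"
      by (auto simp: f_def t_def scaleR_conv_of_real power_mult_distrib divide_inverse mult_ac)
    also have "of_real (g y * \<bar>y\<bar> powr c) * exp (of_real (ln \<bar>y\<bar>) * (w - of_real c)) =
        of_real (g y) * (of_real \<bar>y\<bar> powr w)"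
      using False
      by (simp add: powr_def Ln_of_real exp_of_real[symmetric] exp_add[symmetric] algebra_simps)
    finally show ?thesis .
  qed (simp add: f_def t_def)
  have "(\<lambda>n. integral\<^sup>L M (f n)) sums (\<integral>y. (\<Sum>n. f n y) \<partial>M)"
  proof (rule sums_integral[OF int])
    have "summable (\<lambda>n. norm (f n y))" if "\<bar>y\<bar> \<le> 1" for y
      by (rule summableI_nonneg_bounded[where x = 1]) (auto simp: psum that)
    then show "AE y in M. summable (\<lambda>n. norm (f n y))"
      using M unfolding interval_measure_def by (auto elim: eventually_mono)
    show "summable (\<lambda>n. \<integral>y. norm (f n y) \<partial>M)"
    proof (rule summableI_nonneg_bounded)
      show "(\<Sum>n<N. \<integral>y. norm (f n y) \<partial>M) \<le> 1 * measure M (space M)" for N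
      proof -
        have "(\<Sum>n<N. \<integral>y. norm (f n y) \<partial>M) = (\<integral>y. (\<Sum>n<N. norm (f n y)) \<partial>M)"
          using int by (subst Bochner_Integration.integral_sum) auto
        also have "\<dots> \<le> \<bar>\<integral>y. (\<Sum>n<N. norm (f n y)) \<partial>M\<bar>" by simp
        also have "\<dots> \<le> 1 * measure M (space M)"
          using int by (intro integral_interval_measure_le[OF M] Bochner_Integration.integrable_sum
              integrable_norm) (auto simp: psum sum_nonneg)
        finally show ?thesis .
      qed
    qed simp
  qed
  also have "(\<lambda>y. \<Sum>n. f n y) = (\<lambda>y. of_real (g y) * (of_real \<bar>y\<bar> powr w))"
    using lim by (auto simp: sums_iff)
  also have "(\<lambda>n. integral\<^sup>L M (f n)) = (\<lambda>n. of_real (a n) * (w - of_real c) ^ n)"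
  proof
    fix n
    have "f n = (\<lambda>y. complex_of_real (t n y) * (w - of_real c) ^ n)" by (auto simp: f_def)
    moreover have "a n = integral\<^sup>L M (t n)" by (simp add: a_def t_def[abs_def])
    ultimately show "integral\<^sup>L M (f n) = of_real (a n) * (w - of_real c) ^ n" by simp
  qed
  finally show ?thesis .
qed

text \<open>The right half plane is the union of the discs about \<open>c > 0\<close> of radius \<open>c\<close>.\<close>

lemma integral_powr_holomorphic:
  fixes g :: "real \<Rightarrow> real"
  assumes M: "interval_measure M" and g: "g \<in> borel_measurable borel" "\<And>y. \<bar>g y\<bar> \<le> 1"
  shows "(\<lambda>z. \<integral>y. of_real (g y) * (of_real \<bar>y\<bar> powr z) \<partial>M) holomorphic_on {z. 0 < Re z}"
    (is "?J holomorphic_on _")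
proof -
  have "?J holomorphic_on ball (of_real c) c" if c: "0 < c" for c
    by (rule power_series_holomorphic, rule integral_powr_power_series[OF M g c])
      (auto simp: dist_norm norm_minus_commute)
  then have "?J holomorphic_on (\<Union>c\<in>{0<..}. ball (of_real c) c)"
    by (intro holomorphic_on_UN_open) auto
  moreover have "{z. 0 < Re z} \<subseteq> (\<Union>c\<in>{0<..}. ball (of_real c) c)"
  proof
    fix z :: complex assume z: "z \<in> {z. 0 < Re z}"
    \<comment> \<open>The distance condition \<open>norm (z - c) < c\<close> amounts to \<open>2 * c * Re z > (norm z)\<^sup>2\<close>; this \<open>c\<close> is twice the threshold.\<close>
    define c where "c = (norm z)\<^sup>2 / Re z"
    have "0 < (norm z)\<^sup>2" using z by auto
    then have c: "0 < c" using z by (simp add: c_def)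
    have "c * Re z = (Re z)\<^sup>2 + (Im z)\<^sup>2"
      using z by (simp add: c_def cmod_power2)
    moreover have "0 < c * Re z" using c z by simp
    ultimately have "(Re z - c)\<^sup>2 + (Im z)\<^sup>2 < c\<^sup>2"
      by (simp add: power2_eq_square algebra_simps)
    then have "norm (z - of_real c) < c"
      unfolding cmod_def using c by (intro real_less_lsqrt) auto
    then show "z \<in> (\<Union>c\<in>{0<..}. ball (of_real c) c)"
      using c by (auto simp: dist_norm norm_minus_commute)
  qed
  ultimately show ?thesis by (rule holomorphic_on_subset)
qed

lemma integral_powr_of_real:
  "(\<integral>y. of_real (g y) * (of_real \<bar>y\<bar> powr of_real q) \<partial>M) = complex_of_real (\<integral>y. g y * \<bar>y\<bar> powr q \<partial>M)"
proof -
  have "of_real (g y) * (of_real \<bar>y\<bar> powr of_real q) = complex_of_real (g y * \<bar>y\<bar> powr q)" for y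
    by (simp add: powr_of_real)
  then show ?thesis by (simp only: integral_complex_of_real)
qed

text \<open>Fractions with odd denominator and numerator of prescribed parity are dense. Even numerators serve
for positive arguments of \<open>F\<close>, odd ones for negative arguments.\<close>

lemma exists_fraction_with_parity:
  fixes \<alpha> \<beta> :: real and e :: bool
  assumes "0 \<le> \<alpha>" "\<alpha> < \<beta>"
  shows "\<exists>j m::nat. odd m \<and> 0 < j \<and> (odd j \<longleftrightarrow> e) \<and> \<alpha> < real j / real m \<and> real j / real m < \<beta>"
proof -
  \<comment> \<open>An interval longer than \<open>3\<close> leaves room for two consecutive integers strictly inside.\<close>
  obtain n :: nat where n: "3 / (\<beta> - \<alpha>) < real n" using reals_Archimedean2 by blast
  define m where "m = 2 * n + 1"
  have m: "odd m" "0 < m" by (auto simp: m_def)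
  have "3 < real n * (\<beta> - \<alpha>)" using n assms by (simp add: field_simps)
  also have "\<dots> \<le> real m * (\<beta> - \<alpha>)" using assms by (intro mult_right_mono) (auto simp: m_def)
  finally have l: "real m * \<alpha> + 3 < real m * \<beta>" by (simp add: algebra_simps)
  define i where "i = nat \<lfloor>real m * \<alpha>\<rfloor> + 1"
  have nn: "0 \<le> real m * \<alpha>" using assms by simp
  have i: "real m * \<alpha> < real i" "real i \<le> real m * \<alpha> + 1" "0 < i"
    using nn unfolding i_def by linarith+
  define j where "j = (if odd i \<longleftrightarrow> e then i else i + 1)"
  have j: "odd j \<longleftrightarrow> e" "0 < j" "i \<le> j" "j \<le> i + 1" using i by (auto simp: j_def)
  have "real m * \<alpha> < real j" "real j < real m * \<beta>" using i j l by linarith+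
  then have "\<alpha> < real j / real m" "real j / real m < \<beta>" using m by (simp_all add: field_simps)
  then show ?thesis using j m by blast
qed

section \<open>Functions with non-negative derivatives\<close>

text \<open>The bound \<open>\<rho>\<close> is an extended real throughout, so that bounded and unbounded intervals \<open>(0, \<rho>)\<close> are
treated at once.\<close>

lemma nondecreasing_has_limit_at_right_0:
  fixes f :: "real \<Rightarrow> real" and \<rho> :: ereal
  assumes \<rho>: "0 < \<rho>" and mono: "\<And>x y. 0 < x \<Longrightarrow> x \<le> y \<Longrightarrow> ereal y < \<rho> \<Longrightarrow> f x \<le> f y"
    and nn: "\<And>x. 0 < x \<Longrightarrow> ereal x < \<rho> \<Longrightarrow> 0 \<le> f x"
  shows "\<exists>L\<ge>0. (f \<longlongrightarrow> L) (at_right 0)"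
proof -
  define I where "I = {x. 0 < x \<and> ereal x < \<rho>}"
  define L where "L = Inf (f ` I)"
  obtain y0 where y0: "0 < ereal y0" "ereal y0 < \<rho>" using ereal_dense2[OF \<rho>] by auto
  then have y0I: "y0 \<in> I" by (simp add: I_def)
  have bdd: "bdd_below (f ` I)" by (rule bdd_belowI[of _ 0]) (auto simp: I_def nn)
  have L0: "0 \<le> L" unfolding L_def by (rule cInf_greatest) (use y0I in \<open>auto simp: I_def nn\<close>)
  have le: "L \<le> f x" if "x \<in> I" for x unfolding L_def using bdd that by (intro cInf_lower) auto
  have down: "x \<in> I" if "0 < x" "x < y" "y \<in> I" for x y
    using that by (auto simp: I_def) (metis ereal_less_eq(3) less_imp_le order.strict_trans1)
  have "(f \<longlongrightarrow> L) (at_right 0)"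
  proof (rule order_tendstoI)
    fix l assume "l < L"
    then show "\<forall>\<^sub>F x in at_right 0. l < f x"
      unfolding eventually_at_right_field using y0I le down
      by (intro exI[of _ y0]) (auto simp: I_def intro: less_le_trans)
  next
    fix u assume "L < u"
    then obtain y where y: "y \<in> I" "f y < u"
      unfolding L_def using cInf_lessD[of "f ` I" u] y0I by blast
    have "f x < u" if "0 < x" "x < y" for x
      using mono[of x y] that y by (simp add: I_def)
    then show "\<forall>\<^sub>F x in at_right 0. f x < u"
      unfolding eventually_at_right_field using y by (auto simp: I_def)
  qed
  then show ?thesis using L0 by blast
qed

lemma nondecreasing_if_DERIV_nonneg:
  fixes f :: "real \<Rightarrow> real" and \<rho> :: ereal
  assumes d: "\<And>x. 0 < x \<Longrightarrow> ereal x < \<rho> \<Longrightarrow> (f has_real_derivative f' x) (at x)"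
    and nn: "\<And>x. 0 < x \<Longrightarrow> ereal x < \<rho> \<Longrightarrow> 0 \<le> f' x"
    and xy: "0 < x" "x \<le> y" "ereal y < \<rho>"
  shows "f x \<le> f y"
proof (rule DERIV_nonneg_imp_nondecreasing[OF xy(2)])
  fix t assume "x \<le> t" "t \<le> y"
  then have "0 < t" "ereal t < \<rho>" using xy by (auto intro: le_less_trans[of _ "ereal y"])
  then show "\<exists>z. (f has_real_derivative z) (at t) \<and> 0 \<le> z" using d nn by blast
qed

text \<open>The heart of Bernstein's theorem. With \<open>L k\<close> the limit of the \<open>k\<close>-th derivative at \<open>0\<close>, the Taylor
remainder \<open>R n\<close> at \<open>0\<close> is non-negative and \<open>R n x / x ^ n\<close> is nondecreasing. The induction uses that the
derivative \<open>T\<close> of \<open>S = R (n + 1)\<close> is the remainder of order \<open>n\<close> of the derivative of \<open>D 0\<close>, and that a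
function that vanishes at \<open>0\<close> inherits the monotonicity of \<open>T x / x ^ n\<close> in the form of
\<open>S x / x ^ (n + 1)\<close>.\<close>

lemma taylor_remainder_at_0:
  fixes D :: "nat \<Rightarrow> real \<Rightarrow> real" and L :: "nat \<Rightarrow> real" and \<rho> :: ereal
  assumes d: "\<And>k x. 0 < x \<Longrightarrow> ereal x < \<rho> \<Longrightarrow> (D k has_real_derivative D (Suc k) x) (at x)"
    and nn: "\<And>k x. 0 < x \<Longrightarrow> ereal x < \<rho> \<Longrightarrow> 0 \<le> D k x"
    and L: "\<And>k. (D k \<longlongrightarrow> L k) (at_right 0)"
  defines "R \<equiv> \<lambda>n x. D 0 x - (\<Sum>k<n. L k / fact k * x ^ k)"
  shows "(\<forall>x. 0 < x \<longrightarrow> ereal x < \<rho> \<longrightarrow> 0 \<le> R n x) \<and>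
         (\<forall>x y. 0 < x \<longrightarrow> x \<le> y \<longrightarrow> ereal y < \<rho> \<longrightarrow> R n x / x ^ n \<le> R n y / y ^ n)"
  unfolding R_def using d nn L
proof (induction n arbitrary: D L)
  case 0
  have "D 0 x \<le> D 0 y" if "0 < x" "x \<le> y" "ereal y < \<rho>" for x y
    using nondecreasing_if_DERIV_nonneg[of \<rho> "D 0" "D (Suc 0)"] 0 that by blast
  then show ?case using 0(2) by simp
next
  case (Suc n)
  define S where "S x = D 0 x - (\<Sum>k<Suc n. L k / fact k * x ^ k)" for x
  define T where "T x = D (Suc 0) x - (\<Sum>k<n. L (Suc k) / fact k * x ^ k)" for x
  have IH: "(\<forall>x. 0 < x \<longrightarrow> ereal x < \<rho> \<longrightarrow> 0 \<le> T x) \<and>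
         (\<forall>x y. 0 < x \<longrightarrow> x \<le> y \<longrightarrow> ereal y < \<rho> \<longrightarrow> T x / x ^ n \<le> T y / y ^ n)"
    unfolding T_def using Suc.prems
    by (intro Suc.IH[of "\<lambda>k. D (Suc k)" "\<lambda>k. L (Suc k)"]) auto
  have dS: "(S has_real_derivative T x) (at x)" if x: "0 < x" "ereal x < \<rho>" for x
  proof -
    have "S = (\<lambda>x. D 0 x - (L 0 + (\<Sum>k<n. L (Suc k) / fact (Suc k) * x ^ Suc k)))"
      unfolding S_def by (auto simp: sum.lessThan_Suc_shift simp del: sum.lessThan_Suc)
    moreover have "L (Suc k) / fact (Suc k) * (real (Suc k) * x ^ k) = L (Suc k) / fact k * x ^ k" for k
      by (simp add: divide_simps del: of_nat_Suc)
    ultimately show ?thesis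
      unfolding T_def by (auto intro!: derivative_eq_intros Suc.prems(1) x sum.cong
          simp del: fact_Suc power_Suc simp: mult_ac)
  qed
  have S0: "(S \<longlongrightarrow> 0) (at_right 0)"
  proof -
    have "((\<lambda>x. \<Sum>k<Suc n. L k / fact k * x ^ k) \<longlongrightarrow> (\<Sum>k<Suc n. L k / fact k * 0 ^ k)) (at_right 0)"
      by (intro tendsto_intros)
    moreover have "(\<Sum>k<Suc n. L k / fact k * 0 ^ k) = L 0"
      by (subst sum.lessThan_Suc_shift) simp
    ultimately have "(S \<longlongrightarrow> L 0 - L 0) (at_right 0)"
      unfolding S_def by (intro tendsto_diff Suc.prems(3)) simp
    then show ?thesis by simp
  qed
  have from_0: "0 \<le> h x"
    if x: "0 < x" and h0: "(h \<longlongrightarrow> 0) (at_right 0)" and le: "\<And>e. 0 < e \<Longrightarrow> e \<le> x \<Longrightarrow> h e \<le> h x"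
    for h :: "real \<Rightarrow> real" and x
  proof (rule tendsto_upperbound[OF h0])
    show "\<forall>\<^sub>F e in at_right 0. h e \<le> h x"
      unfolding eventually_at_right_field using x le by (intro exI[of _ x]) auto
  qed simp
  have S_nn: "0 \<le> S x" if "0 < x" "ereal x < \<rho>" for x
  proof (rule from_0[OF that(1) S0])
    fix e assume "0 < e" "e \<le> x"
    then show "S e \<le> S x"
      using nondecreasing_if_DERIV_nonneg[of \<rho> S T] dS IH that by blast
  qed
  \<comment> \<open>This is the sign of the numerator in the derivative of \<open>S x / x ^ (n + 1)\<close>. It comes from
    comparing \<open>S\<close> on \<open>(0, x]\<close> with the multiple of \<open>t ^ (n + 1)\<close> whose derivative equals that of \<open>S\<close> at \<open>x\<close>.\<close>
  have ST: "(real n + 1) * S x \<le> x * T x" if x: "0 < x" "ereal x < \<rho>" for x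
  proof -
    define C where "C = T x / x ^ n / (real n + 1)"
    have C: "C * (real n + 1) = T x / x ^ n" 
      using nonzero_eq_divide_eq[of "real n + 1" C "T x / x ^ n"] C_def by linarith
    define h where "h t = C * t ^ Suc n - S t" for t
    have "0 \<le> h x"
    proof (rule from_0[OF x(1)])
      have "((\<lambda>t. C * t ^ Suc n - S t) \<longlongrightarrow> C * 0 ^ Suc n - 0) (at_right 0)"
        by (intro tendsto_intros S0)
      then show "(h \<longlongrightarrow> 0) (at_right 0)" unfolding h_def by simp
      fix e assume e: "0 < e" "e \<le> x"
      show "h e \<le> h x"
      proof (rule DERIV_nonneg_imp_nondecreasing[OF e(2)])
        fix t assume t: "e \<le> t" "t \<le> x"
        have t': "0 < t" "ereal t < \<rho>" using e t x by (auto intro: le_less_trans[of _ "ereal x"])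
        have "(h has_real_derivative T x / x ^ n * t ^ n - T t) (at t)"
        proof -
          have "(h has_real_derivative C * (real (Suc n) * t ^ n) - T t) (at t)"
            unfolding h_def using DERIV_pow[of "Suc n" t]
            by (intro DERIV_diff DERIV_cmult dS[OF t']) simp
          moreover have "C * (real (Suc n) * t ^ n) = C * (real n + 1) * t ^ n" by simp
          ultimately show ?thesis unfolding C by simp
        qed
        moreover have "T t / t ^ n \<le> T x / x ^ n" using IH t t' x by blast
        then have "T t \<le> T x / x ^ n * t ^ n" using t' by (simp add: pos_divide_le_eq)
        ultimately show "\<exists>z. (h has_real_derivative z) (at t) \<and> 0 \<le> z"
          by (intro exI[of _ "T x / x ^ n * t ^ n - T t"]) simp
      qed
    qed
    then have "S x \<le> C * x ^ Suc n" by (simp add: h_def)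
    then have "(real n + 1) * S x \<le> (real n + 1) * (C * x ^ Suc n)" by (intro mult_left_mono) auto
    also have "\<dots> = (C * (real n + 1)) * x ^ n * x" by (simp add: mult_ac)
    also have "\<dots> = x * T x" unfolding C using x by simp
    finally show ?thesis .
  qed
  have "S x / x ^ Suc n \<le> S y / y ^ Suc n" if xy: "0 < x" "x \<le> y" "ereal y < \<rho>" for x y
  proof (rule nondecreasing_if_DERIV_nonneg[OF _ _ xy])
    fix t assume t: "0 < t" "ereal t < \<rho>"
    show "((\<lambda>x. S x / x ^ Suc n) has_real_derivative (t * T t - (real n + 1) * S t) / t ^ (n + 2)) (at t)"
    proof -
      have "((\<lambda>x. S x / x ^ Suc n) has_real_derivative
          (T t * t ^ Suc n - S t * (real (Suc n) * t ^ n)) / (t ^ Suc n * t ^ Suc n)) (at t)"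
        using DERIV_pow[of "Suc n" t] t by (intro DERIV_divide dS[OF t]) simp_all
      also have "(T t * t ^ Suc n - S t * (real (Suc n) * t ^ n)) / (t ^ Suc n * t ^ Suc n) =
          (t ^ n * (t * T t - (real n + 1) * S t)) / (t ^ n * t ^ (n + 2))"
        by (simp add: algebra_simps)
      finally show ?thesis using t by simp
    qed
    show "0 \<le> (t * T t - (real n + 1) * S t) / t ^ (n + 2)"
      using ST[OF t] t by simp
  qed
  then show ?case using S_nn unfolding S_def by blast
qed

text \<open>Bernstein's theorem. Monotonicity of \<open>R n x / x ^ n\<close> gives \<open>0 \<le> R n x \<le> D 0 y * (x / y) ^ n\<close> for every
\<open>y\<close> between \<open>x\<close> and \<open>\<rho>\<close>, so the Taylor series at \<open>0\<close> converges to the function on all of \<open>(0, \<rho>)\<close>. The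
coefficients are right-hand limits, as \<open>0\<close> is an end point of the interval.\<close>

lemma power_series_if_derivatives_nonneg:
  fixes D :: "nat \<Rightarrow> real \<Rightarrow> real" and \<rho> :: ereal
  assumes \<rho>: "0 < \<rho>"
    and d: "\<And>k x. 0 < x \<Longrightarrow> ereal x < \<rho> \<Longrightarrow> (D k has_real_derivative D (Suc k) x) (at x)"
    and nn: "\<And>k x. 0 < x \<Longrightarrow> ereal x < \<rho> \<Longrightarrow> 0 \<le> D k x"
  obtains a where "\<And>k. 0 \<le> a k" "\<And>x. 0 < x \<Longrightarrow> ereal x < \<rho> \<Longrightarrow> (\<lambda>k. a k * x ^ k) sums D 0 x"
proof -
  have "\<exists>L\<ge>0. (D k \<longlongrightarrow> L) (at_right 0)" for k
  proof (rule nondecreasing_has_limit_at_right_0[OF \<rho> _ nn])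
    show "D k x \<le> D k y" if "0 < x" "x \<le> y" "ereal y < \<rho>" for x y
      using nondecreasing_if_DERIV_nonneg[of \<rho> "D k" "D (Suc k)"] d nn that by blast
  qed
  then obtain L where L: "\<And>k. 0 \<le> L k" "\<And>k. (D k \<longlongrightarrow> L k) (at_right 0)" by metis
  define a where "a k = L k / fact k" for k
  have a: "0 \<le> a k" for k using L by (simp add: a_def)
  define R where "R n x = D 0 x - (\<Sum>k<n. a k * x ^ k)" for n x
  have R: "\<And>x. 0 < x \<Longrightarrow> ereal x < \<rho> \<Longrightarrow> 0 \<le> R n x"
      "\<And>x y. 0 < x \<Longrightarrow> x \<le> y \<Longrightarrow> ereal y < \<rho> \<Longrightarrow> R n x / x ^ n \<le> R n y / y ^ n" for n
    using taylor_remainder_at_0[of \<rho> D L n] d nn L(2) unfolding R_def a_def by blast+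
  have "(\<lambda>k. a k * x ^ k) sums D 0 x" if x: "0 < x" "ereal x < \<rho>" for x
  proof -
    obtain y where y: "x < y" "ereal y < \<rho>" using ereal_dense2[OF x(2)] by auto
    have "R n x \<le> D 0 y * (x / y) ^ n" for n
    proof -
      have "R n x = R n x / x ^ n * x ^ n" using x by simp
      also have "\<dots> \<le> R n y / y ^ n * x ^ n"
        using R(2)[of x y n] x y by (intro mult_right_mono) auto
      also have "\<dots> = R n y * (x / y) ^ n" by (simp add: power_divide)
      also have "\<dots> \<le> D 0 y * (x / y) ^ n"
        using x y a by (intro mult_right_mono) (auto simp: R_def intro!: sum_nonneg)
      finally show ?thesis .
    qed
    moreover have "(\<lambda>n. D 0 y * (x / y) ^ n) \<longlonglongrightarrow> D 0 y * 0"
      using x y by (intro tendsto_intros LIMSEQ_realpow_zero) auto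
    ultimately have "(\<lambda>n. R n x) \<longlonglongrightarrow> 0"
      using R(1)[OF x] by (intro tendsto_sandwich[of "\<lambda>_. 0" "\<lambda>n. R n x" sequentially "\<lambda>n. D 0 y * (x / y) ^ n"]) auto
    then have "(\<lambda>n. D 0 x - R n x) \<longlonglongrightarrow> D 0 x - 0" by (intro tendsto_intros)
    then show ?thesis unfolding sums_def R_def by simp
  qed
  then show ?thesis using that a by blast
qed

lemma ball_subset_eball:
  fixes z :: "'a::metric_space"
  assumes "ereal K < \<rho>"
  shows "ball z K \<subseteq> eball z \<rho>"
proof
  fix w assume "w \<in> ball z K"
  then have "ereal (dist z w) < ereal K" by simp
  then have "ereal (dist z w) < \<rho>" using assms by (rule less_trans)
  then show "w \<in> eball z \<rho>" by simp
qed

text \<open>Termwise differentiation keeps the coefficients non-negative.\<close>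

lemma absolutely_monotonic_on_disc_if_power_series:
  fixes a :: "nat \<Rightarrow> real"
  assumes a: "\<And>k. 0 \<le> a k"
    and s: "\<And>z. z \<in> eball 0 \<rho> \<Longrightarrow> (\<lambda>k. of_real (a k) * z ^ k) sums f z"
  shows "absolutely_monotonic_on_disc \<rho> f"
proof -
  have *: "\<exists>b. (\<forall>k. 0 \<le> b k) \<and> (\<forall>z\<in>eball 0 \<rho>. (\<lambda>k. of_real (b k) * z ^ k) sums (deriv ^^ n) f z)" for n
  proof (induction n)
    case 0
    then show ?case using a s by (intro exI[of _ a]) auto
  next
    case (Suc n)
    then obtain b where b: "\<And>k. 0 \<le> b k"
      "\<And>z. z \<in> eball 0 \<rho> \<Longrightarrow> (\<lambda>k. of_real (b k) * z ^ k) sums (deriv ^^ n) f z" by blast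
    have "(\<lambda>k. of_real (diffs b k) * z ^ k) sums (deriv ^^ Suc n) f z" if z: "z \<in> eball 0 \<rho>" for z
    proof -
      have "ereal (norm z) < \<rho>" using z by (simp add: eball_def)
      then obtain K where K: "norm z < K" "ereal K < \<rho>" using ereal_dense2[of "ereal (norm z)" \<rho>] by auto
      have sub: "w \<in> eball 0 \<rho>" if "norm w < K" for w :: complex
        using ball_subset_eball[OF K(2), of "0 :: complex"] that by auto
      have "(deriv ^^ n) f holomorphic_on ball 0 K"
      proof (rule power_series_holomorphic)
        show "(\<lambda>k. of_real (b k) * (w - 0) ^ k) sums (deriv ^^ n) f w" if "w \<in> ball 0 K" for w
          using b(2)[OF sub, of w] that by simp
      qed
      then have "((deriv ^^ n) f has_field_derivative deriv ((deriv ^^ n) f) z) (at z)"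
        using K(1) by (intro holomorphic_derivI[of _ "ball 0 K"]) auto
      then have "(\<lambda>k. diffs (\<lambda>k. complex_of_real (b k)) k * z ^ k) sums deriv ((deriv ^^ n) f) z"
        using b(2) sub K(1) by (intro termdiffs_sums_strong[of K]) auto
      moreover have "diffs (\<lambda>k. complex_of_real (b k)) k = of_real (diffs b k)" for k
        by (simp add: diffs_def)
      ultimately show ?thesis by simp
    qed
    moreover have "0 \<le> diffs b k" for k using b by (simp add: diffs_def)
    ultimately show ?case by (intro exI[of _ "diffs b"]) blast
  qed
  have "f holomorphic_on eball 0 \<rho>"
  proof -
    have "f field_differentiable (at z)" if z: "z \<in> eball 0 \<rho>" for z
    proof -
      have "ereal (norm z) < \<rho>" using z by (simp add: eball_def)
      then obtain K where K: "norm z < K" "ereal K < \<rho>" using ereal_dense2[of "ereal (norm z)" \<rho>] by auto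
      have sub: "w \<in> eball 0 \<rho>" if "norm w < K" for w :: complex
        using ball_subset_eball[OF K(2), of "0 :: complex"] that by auto
      have "f holomorphic_on ball 0 K"
      proof (rule power_series_holomorphic)
        show "(\<lambda>k. of_real (a k) * (w - 0) ^ k) sums f w" if "w \<in> ball 0 K" for w
          using s[OF sub, of w] that by simp
      qed
      then show ?thesis
        using K(1) by (simp add: holomorphic_on_imp_differentiable_at)
    qed
    then show ?thesis
      unfolding holomorphic_on_def by (blast intro: field_differentiable_at_within)
  qed
  moreover have "(deriv ^^ n) f (of_real x) / fact n \<in> \<real>\<^sub>\<ge>\<^sub>0" if x: "0 < x" "ereal x < \<rho>" for x n
  proof -
    obtain b where b: "\<And>k. 0 \<le> b k"
      "\<And>z. z \<in> eball 0 \<rho> \<Longrightarrow> (\<lambda>k. of_real (b k) * z ^ k) sums (deriv ^^ n) f z" using * by blast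
    have "(\<lambda>k. complex_of_real (b k * x ^ k)) sums (deriv ^^ n) f (of_real x)"
      using b(2)[of "of_real x"] x by simp
    note lim = this
    define c where "c = Re ((deriv ^^ n) f (of_real x))"
    have c: "(\<lambda>k. b k * x ^ k) sums c" using sums_Re[OF lim] by (simp add: c_def)
    then have "(deriv ^^ n) f (of_real x) = complex_of_real c"
      using sums_unique2[OF lim] sums_of_real by blast
    have "0 \<le> c" using b(1) x by (intro sums_le[OF _ sums_zero c]) auto
    then have "complex_of_real (c / fact n) \<in> \<real>\<^sub>\<ge>\<^sub>0"
      unfolding nonneg_Reals_of_real_iff by simp
    then show ?thesis using \<open>(deriv ^^ n) f (of_real x) = complex_of_real c\<close> by simp
  qed
  ultimately show ?thesis unfolding absolutely_monotonic_on_disc_def by blast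
qed

text \<open>The Taylor coefficients at \<open>0\<close> are limits of those at positive points.\<close>

lemma absolutely_monotonic_on_disc_power_series:
  assumes f: "absolutely_monotonic_on_disc \<rho> f" and \<rho>: "0 < \<rho>"
  obtains a where "\<And>k. 0 \<le> a k"
    "\<And>z. z \<in> eball 0 \<rho> \<Longrightarrow> (\<lambda>k. complex_of_real (a k) * z ^ k) sums f z"
proof -
  have hol: "f holomorphic_on eball 0 \<rho>" and
    nn: "\<And>x n. 0 < x \<Longrightarrow> ereal x < \<rho> \<Longrightarrow> (deriv ^^ n) f (of_real x) / fact n \<in> \<real>\<^sub>\<ge>\<^sub>0"
    using f unfolding absolutely_monotonic_on_disc_def by auto
  have c0: "(deriv ^^ n) f 0 / fact n \<in> \<real>\<^sub>\<ge>\<^sub>0" for n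
  proof -
    obtain K where K: "0 < K" "ereal K < \<rho>" using ereal_dense2[OF \<rho>] by auto
    let ?g = "\<lambda>z. (deriv ^^ n) f z / fact n"
    have "?g holomorphic_on eball 0 \<rho>"
      by (intro holomorphic_intros holomorphic_higher_deriv hol) auto
    then have "isCont ?g 0"
      using \<rho> by (intro continuous_on_interior[of "eball 0 \<rho>"] holomorphic_on_imp_continuous_on)
        (auto simp: interior_open zero_ereal_def)
    \<comment> \<open>A sequence of positive points of the disc that tends to its centre.\<close>
    moreover have "(\<lambda>m. complex_of_real (K / real (m + 2))) \<longlonglongrightarrow> of_real 0"
      by (intro tendsto_of_real) real_asymp
    ultimately have "(\<lambda>m. ?g (complex_of_real (K / real (m + 2)))) \<longlonglongrightarrow> ?g 0"
      by (intro isCont_tendsto_compose[of _ ?g]) auto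
    moreover have "?g (complex_of_real (K / real (m + 2))) \<in> \<real>\<^sub>\<ge>\<^sub>0" for m
    proof (rule nn)
      show "0 < K / real (m + 2)" using K by simp
      have "K / real (m + 2) \<le> K" using K by (simp add: field_simps)
      then show "ereal (K / real (m + 2)) < \<rho>" using K(2) by (meson ereal_less_eq(3) le_less_trans)
    qed
    ultimately show ?thesis
      by (rule closed_sequentially[OF closed_nonneg_Reals_complex, rotated])
  qed
  define a where "a n = Re ((deriv ^^ n) f 0 / fact n)" for n
  have a: "0 \<le> a n" "of_real (a n) = (deriv ^^ n) f 0 / fact n" for n
    using c0[of n] unfolding a_def complex_nonneg_Reals_iff by (auto intro: complex_eqI)
  have "(\<lambda>k. complex_of_real (a k) * z ^ k) sums f z" if z: "z \<in> eball 0 \<rho>" for z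
  proof -
    have "ereal (norm z) < \<rho>" using z by (simp add: eball_def)
    then obtain K where K: "norm z < K" "ereal K < \<rho>" using ereal_dense2[of "ereal (norm z)" \<rho>] by auto
    have "ball 0 K \<subseteq> (eball 0 \<rho> :: complex set)"
      using K(2) by (rule ball_subset_eball)
    then have "f holomorphic_on ball 0 K" using hol holomorphic_on_subset by blast
    then show ?thesis using holomorphic_power_series[of f 0 K z] K(1) unfolding a(2) by simp
  qed
  then show ?thesis using that a(1) by blast
qed

section \<open>Absolutely monotonic functions preserve moment sequences\<close>

text \<open>The law of the product of two independent variables.\<close>

lemma multiplicative_convolution:
  assumes M: "interval_measure M" "prob_space M" and N: "interval_measure N" "prob_space N"
  obtains P where "interval_measure P" "prob_space P" "\<And>k. moment P k = moment M k * moment N k"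
proof -
  interpret M: prob_space M by fact
  interpret N: prob_space N by fact
  interpret MN: pair_prob_space M N ..
  have sM [measurable_cong]: "sets M = sets borel" and sN [measurable_cong]: "sets N = sets borel"
    using M N by (auto simp: interval_measure_def)
  define P where "P = distr (M \<Otimes>\<^sub>M N) borel (\<lambda>z. fst z * snd z)"
  have meas: "(\<lambda>z. fst z * snd z) \<in> measurable (M \<Otimes>\<^sub>M N) borel"
    by measurable
  have ae: "AE z in M \<Otimes>\<^sub>M N. \<bar>fst z\<bar> \<le> 1 \<and> \<bar>snd z\<bar> \<le> 1"
  proof (rule MN.AE_pair_measure)
    show "{z \<in> space (M \<Otimes>\<^sub>M N). \<bar>fst z\<bar> \<le> 1 \<and> \<bar>snd z\<bar> \<le> 1} \<in> sets (M \<Otimes>\<^sub>M N)"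
      by measurable
    have "AE x in M. \<bar>x\<bar> \<le> 1" "AE y in N. \<bar>y\<bar> \<le> 1"
      using M N by (auto simp: interval_measure_def)
    then show "AE x in M. AE y in N. \<bar>fst (x, y)\<bar> \<le> 1 \<and> \<bar>snd (x, y)\<bar> \<le> 1"
      by simp
  qed
  have P: "prob_space P"
    unfolding P_def using meas by (rule MN.prob_space_distr)
  moreover have "interval_measure P"
    unfolding interval_measure_def
  proof (intro conjI)
    show "sets P = sets borel" by (simp add: P_def)
    show "finite_measure P" using P by (simp add: prob_space.finite_measure)
    have "AE z in M \<Otimes>\<^sub>M N. \<bar>fst z * snd z\<bar> \<le> 1"
      using ae by eventually_elim (auto simp: abs_mult intro: mult_le_one)
    then show "AE x in P. \<bar>x\<bar> \<le> 1"
      unfolding P_def by (subst AE_distr_iff[OF meas]) auto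
  qed
  moreover have "moment P k = moment M k * moment N k" for k
  proof -
    have "moment P k = (\<integral>z. (fst z * snd z) ^ k \<partial>(M \<Otimes>\<^sub>M N))"
      unfolding moment_def P_def by (rule integral_distr[OF meas]) simp
    also have "\<dots> = (\<integral>x. (\<integral>y. (fst (x, y) * snd (x, y)) ^ k \<partial>N) \<partial>M)"
    proof (rule MN.integral_fst'[symmetric], rule MN.integrable_const_bound)
      show "AE z in M \<Otimes>\<^sub>M N. norm ((fst z * snd z) ^ k) \<le> 1"
        using ae by eventually_elim (auto simp: abs_mult power_abs intro!: power_le_one mult_le_one)
    qed measurable
    also have "\<dots> = moment M k * moment N k"
      by (simp add: moment_def power_mult_distrib)
    finally show ?thesis .
  qed
  ultimately show ?thesis using that by blast
qed

lemma moment_powers: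
  assumes M: "interval_measure M" "prob_space M"
  shows "\<exists>P. interval_measure P \<and> prob_space P \<and> (\<forall>k. moment P k = moment M k ^ n)"
proof (induction n)
  case 0
  have "interval_measure (return borel 1)"
    unfolding interval_measure_def
    by (auto simp: AE_return prob_space_return prob_space.finite_measure)
  moreover have "moment (return borel 1) k = 1" for k
    by (simp add: moment_def integral_return)
  ultimately show ?case by (intro exI[of _ "return borel 1"]) (simp add: prob_space_return)
next
  case (Suc n)
  then obtain P where P: "interval_measure P" "prob_space P" "\<And>k. moment P k = moment M k ^ n"
    by blast
  then obtain Q where "interval_measure Q" "prob_space Q" "\<And>k. moment Q k = moment M k * moment P k"
    using multiplicative_convolution[OF M P(1,2)] by blast
  then show ?case using P(3) by auto
qed

text \<open>The mixture is a measure obtained by first choosing an index with weight \<open>w n\<close> and then a point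
according to \<open>N n\<close>.\<close>

lemma countable_mixture_of_moments:
  fixes N :: "nat \<Rightarrow> real measure" and w :: "nat \<Rightarrow> real"
  assumes N: "\<And>n. interval_measure (N n)" "\<And>n. prob_space (N n)"
    and w: "\<And>n. 0 \<le> w n" "summable w"
  shows "(\<lambda>k. \<Sum>n. w n * moment (N n) k) \<in> moment_sequences {-1..1}"
proof -
  define W where "W = density (count_space (UNIV :: nat set)) w"
  define M where "M = W \<bind> N"
  have sN: "sets (N n) = sets borel" for n using N by (simp add: interval_measure_def)
  have kernel [measurable]: "N \<in> measurable W (subprob_algebra borel)"
    unfolding W_def using N sN
    by (auto simp: space_subprob_algebra prob_space_imp_subprob_space)
  have W_fin: "finite_measure W"
  proof
    have "emeasure W (space W) = (\<Sum>n. ennreal (w n))"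
      by (simp add: W_def emeasure_density nn_integral_count_space_nat)
    also have "\<dots> = ennreal (\<Sum>n. w n)" using w by (intro suminf_ennreal2)
    finally show "emeasure W (space W) \<noteq> \<infinity>" by simp
  qed
  have sM: "sets M = sets borel"
    unfolding M_def using sN by (intro sets_bind) (simp_all add: W_def)
  have one: "AE n in W. emeasure (N n) (space (N n)) \<le> ennreal 1"
    using N by (simp add: prob_space.emeasure_space_1)
  have ae: "AE x in M. \<bar>x\<bar> \<le> 1"
    unfolding M_def using N by (subst AE_bind[OF kernel]) (auto simp: interval_measure_def)
  \<comment> \<open>The integral formula for mixtures asks for a function that is bounded on the whole line, while
    powers are bounded only on the support; truncation reconciles the two.\<close>
  define c where "c x = max (- 1) (min 1 x)" for x :: real
  have c_meas [measurable]: "c \<in> borel_measurable borel" unfolding c_def by measurable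
  have c: "\<bar>x\<bar> \<le> 1 \<Longrightarrow> c x = x" "\<bar>c x ^ k\<bar> \<le> 1" for x k
    by (auto simp: c_def power_abs intro!: power_le_one)
  have clamp: "(\<integral>x. c x ^ k \<partial>L) = moment L k"
    if "sets L = sets borel" "AE x in L. \<bar>x\<bar> \<le> 1" for k L
    unfolding moment_def
  proof (rule integral_cong_AE)
    show "(\<lambda>x. c x ^ k) \<in> borel_measurable L" "(\<lambda>x. x ^ k) \<in> borel_measurable L"
      by (simp_all add: measurable_cong_sets[OF that(1) refl])
    show "AE x in L. c x ^ k = x ^ k"
      using that(2) by eventually_elim (simp add: c)
  qed
  have "emeasure M (space M) = (\<integral>\<^sup>+n. emeasure (N n) (space M) \<partial>W)"
    unfolding M_def
    by (rule emeasure_bind[OF _ kernel]) (use sM sets.top[of M] in \<open>simp_all add: M_def W_def\<close>)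
  also have "\<dots> = emeasure W (space W)"
  proof -
    have "emeasure (N n) (space M) = 1" for n
      using prob_space.emeasure_space_1[OF N(2)] sets_eq_imp_space_eq[OF sM] sets_eq_imp_space_eq[OF sN]
      by metis
    then show ?thesis by simp
  qed
  finally have "finite_measure M"
    using finite_measure.emeasure_finite[OF W_fin] by (intro finite_measureI) simp
  then have M: "interval_measure M" using sM ae by (simp add: interval_measure_def)
  have "moment M k = (\<Sum>n. w n * moment (N n) k)" for k
  proof -
    have "moment M k = (\<integral>x. c x ^ k \<partial>M)" using clamp[OF sM ae] by simp
    also have "\<dots> = (\<integral>n. (\<integral>x. c x ^ k \<partial>N n) \<partial>W)"
      unfolding M_def
      by (rule integral_bind[where K = borel and B = 1 and B' = 1])
        (use c W_fin one in auto)
    also have "\<dots> = (\<integral>n. moment (N n) k \<partial>W)"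
      using N by (simp add: clamp interval_measure_def)
    also have "\<dots> = (\<integral>n. w n * moment (N n) k \<partial>count_space UNIV)"
      unfolding W_def using w by (subst integral_density) auto
    also have "\<dots> = (\<Sum>n. w n * moment (N n) k)"
    proof (rule integral_count_space_nat)
      have "\<bar>moment (N n) k\<bar> \<le> 1" for n
        using abs_moment_le_mass[OF N(1), of n k] prob_space.prob_space[OF N(2), of n] by simp
      then have "norm (w n * moment (N n) k) \<le> w n" for n
        using mult_left_mono[of "\<bar>moment (N n) k\<bar>" 1 "w n"] w by (simp add: abs_mult)
      then show "integrable (count_space UNIV) (\<lambda>n. w n * moment (N n) k)"
        unfolding integrable_count_space_nat_iff using w(2)
        by (intro summable_comparison_test[OF _ w(2)]) auto
    qed
    finally show ?thesis .
  qed
  then show ?thesis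
    unfolding moment_sequences_interval_iff using M by auto
qed

text \<open>Write \<open>s k = s 0 * p k\<close> with \<open>p\<close> the moments of a probability measure. Then
\<open>a n * s k ^ n = (a n * s 0 ^ n) * p k ^ n\<close> is a mixture of powers of moments, and the total weight
\<open>\<Sum>n. a n * s 0 ^ n\<close> is finite because the series converges for \<open>k = 0\<close>.\<close>

lemma power_series_preserves_moment_sequences:
  assumes s: "s \<in> moment_sequences {-1..1}" and a: "\<And>n. 0 \<le> a n"
    and sums: "\<And>k. (\<lambda>n. a n * s k ^ n) sums t k"
  shows "t \<in> moment_sequences {-1..1}"
proof -
  obtain M where M: "interval_measure M" "moment M = s"
    using s unfolding moment_sequences_interval_iff by blast
  interpret finite_measure M using M by (simp add: interval_measure_def)
  have s0: "s 0 = measure M (space M)" using M(2) by (auto simp: moment_def)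
  \<comment> \<open>If the total mass vanishes, all moments do, and any probability measure will serve.\<close>
  have "\<exists>P. interval_measure P \<and> prob_space P \<and> (\<forall>k. s k = s 0 * moment P k)"
  proof (cases "s 0 = 0")
    case True
    have "s k = 0" for k
      using abs_moment_le_mass[OF M(1), of k] s0 True M(2) by simp
    moreover have "interval_measure (return borel 1)"
      unfolding interval_measure_def
      by (auto simp: AE_return prob_space_return prob_space.finite_measure)
    ultimately show ?thesis using True by (auto intro!: exI[of _ "return borel 1"] prob_space_return)
  next
    case False
    then have pos: "0 < s 0" using s0 by (simp add: zero_less_measure_iff)
    define P where "P = density M (\<lambda>_. ennreal (1 / s 0))"
    have "emeasure P (space P) = ennreal (1 / s 0) * emeasure M (space M)"
      by (simp add: P_def emeasure_density_const)
    also have "\<dots> = 1" using pos by (simp add: emeasure_eq_measure flip: s0 ennreal_mult)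
    finally have P: "prob_space P" by (rule prob_spaceI)
    moreover have "interval_measure P"
      unfolding interval_measure_def
    proof (intro conjI)
      show "sets P = sets borel" using M by (simp add: P_def interval_measure_def)
      show "finite_measure P" using P by (simp add: prob_space.finite_measure)
      show "AE x in P. \<bar>x\<bar> \<le> 1"
        unfolding P_def using M by (subst AE_density) (auto simp: interval_measure_def)
    qed
    moreover have "s k = s 0 * moment P k" for k
    proof -
      have "(\<lambda>x. x ^ k) \<in> borel_measurable M"
        using integrable_power_interval_measure[OF M(1)] by (rule borel_measurable_integrable)
      then have "moment P k = 1 / s 0 * s k"
        unfolding P_def M(2)[symmetric] moment_def using pos M(2) by (subst integral_density) auto
      then show ?thesis using pos by simp
    qed
    ultimately show ?thesis by blast
  qed
  then obtain P where P: "interval_measure P" "prob_space P" "\<And>k. s k = s 0 * moment P k" by blast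
  obtain N where N: "\<And>n. interval_measure (N n)" "\<And>n. prob_space (N n)"
    "\<And>n k. moment (N n) k = moment P k ^ n"
    using moment_powers[OF P(1,2)] by metis
  have s0_nn: "0 \<le> s 0" using s0 by simp
  have "(\<lambda>k. \<Sum>n. (a n * s 0 ^ n) * moment (N n) k) \<in> moment_sequences {-1..1}"
    using N a sums[of 0] s0_nn by (intro countable_mixture_of_moments) (auto simp: sums_iff)
  also have "(\<lambda>k. \<Sum>n. (a n * s 0 ^ n) * moment (N n) k) = t"
  proof
    fix k
    have "(\<Sum>n. (a n * s 0 ^ n) * moment (N n) k) = (\<Sum>n. a n * s k ^ n)"
      unfolding N(3) P(3)[of k] by (simp add: power_mult_distrib mult.assoc)
    also have "\<dots> = t k" using sums[of k] by (simp add: sums_iff)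
    finally show "(\<Sum>n. (a n * s 0 ^ n) * moment (N n) k) = t k" .
  qed
  finally show ?thesis .
qed

section \<open>Functions acting on moment sequences of three atoms\<close>

lemma ereal_in_symmetric_interval_iff: "ereal x \<in> {-\<rho><..<\<rho>} \<longleftrightarrow> ereal \<bar>x\<bar> < \<rho>"
  by (cases \<rho>) auto

lemma three_atoms_in_bounded_moment_sequences:
  assumes "0 \<le> a" "0 \<le> b" "0 \<le> c" "ereal (a + b + c) < \<rho>" "0 < u" "u < 1"
  shows "(\<lambda>k. a * (-1) ^ k + b * u ^ k + c) \<in> bounded_moment_sequences \<rho> {-1, u, 1}"
proof -
  define w where "w x = (if x = -1 then a else if x = u then b else c)" for x :: real
  have "(\<lambda>k. \<Sum>x\<in>{-1, u, 1}. w x * x ^ k) \<in> moment_sequences {-1, u, 1}"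
    using assms by (intro atomic_moment_sequence) (auto simp: w_def)
  also have "(\<lambda>k. \<Sum>x\<in>{-1, u, 1}. w x * x ^ k) = (\<lambda>k. a * (-1) ^ k + b * u ^ k + c)"
    using assms by (auto simp: w_def)
  finally have "(\<lambda>k. a * (-1) ^ k + b * u ^ k + c) \<in> moment_sequences {-1, u, 1}" .
  moreover have "ereal \<bar>a * (-1) ^ k + b * u ^ k + c\<bar> < \<rho>" for k
  proof -
    have "b * u ^ k \<le> b * 1" using assms by (intro mult_left_mono power_le_one) auto
    moreover have "\<bar>a * (-1) ^ k\<bar> = a" using assms by (simp add: abs_mult)
    moreover have "0 \<le> b * u ^ k" using assms by simp
    ultimately have "\<bar>a * (-1) ^ k + b * u ^ k + c\<bar> \<le> a + b + c"
      using assms by linarith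
    then show ?thesis using assms by (meson ereal_less_eq(3) le_less_trans)
  qed
  ultimately show ?thesis
    unfolding bounded_moment_sequences_def mem_Collect_eq ereal_in_symmetric_interval_iff by blast
qed

lemma integral_poly_admissible:
  assumes "admissible_measure M"
  shows "(\<integral>x. poly p x \<partial>M) = (\<Sum>i\<le>degree p. coeff p i * moment M i)"
  using assms unfolding admissible_measure_def moment_def poly_altdef
  by (subst Bochner_Integration.integral_sum) auto

lemma hankel_form_nonneg:
  assumes "s \<in> moment_sequences K"
  shows "0 \<le> (\<Sum>i\<le>degree (p * p). coeff (p * p) i * s i)"
proof -
  obtain M where M: "admissible_measure M" "s = moment M"
    using assms unfolding moment_sequences_def by auto
  have "0 \<le> (\<integral>x. poly (p * p) x \<partial>M)" by (intro Bochner_Integration.integral_nonneg) simp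
  then show ?thesis unfolding integral_poly_admissible[OF M(1)] M(2) .
qed

text \<open>The first condition of the theorem with the measures on \<open>{-1, u, 1}\<close> spelled out. Since masses are
non-negative, the moments are bounded by the total mass, so a single inequality expresses that all
of them lie in \<open>(-\<rho>, \<rho>)\<close>.\<close>

locale three_atom_preserver =
  fixes F :: "real \<Rightarrow> real" and \<rho> :: ereal
  assumes \<rho>_pos: "0 < \<rho>"
    and preserves: "\<And>a b c u. \<lbrakk>0 \<le> a; 0 \<le> b; 0 \<le> c; ereal (a + b + c) < \<rho>; 0 < u; u < 1\<rbrakk> \<Longrightarrow>
      (\<lambda>k. F (a * (-1) ^ k + b * u ^ k + c)) \<in> moment_sequences UNIV"
begin

text \<open>The two masses at \<open>1\<close> and \<open>-1\<close> are chosen such that the even moments equal \<open>x\<close> and the odd ones equal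
\<open>y\<close>. Integrating \<open>(1 + t)\<^sup>2\<close> and \<open>(1 - t)\<^sup>2\<close> against the representing measure gives
\<open>2 * F x + 2 * F y \<ge> 0\<close> and \<open>2 * F x - 2 * F y \<ge> 0\<close>.\<close>

lemma abs_F_le:
  assumes "\<bar>y\<bar> \<le> x" "ereal x < \<rho>"
  shows "\<bar>F y\<bar> \<le> F x"
proof -
  define s where "s k = F ((x - y) / 2 * (-1) ^ k + 0 * (1/2) ^ k + (x + y) / 2)" for k :: nat
  have "s \<in> moment_sequences UNIV"
    unfolding s_def using assms by (intro preserves) (auto simp: field_simps)
  note h = hankel_form_nonneg[OF this]
  have s: "s 0 = F x" "s (Suc 0) = F y" "s (Suc (Suc 0)) = F x"
    by (auto simp: s_def field_simps intro: arg_cong[of _ _ F])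
  show ?thesis using h[of "[:1, 1:]"] h[of "[:1, -1:]"] by (simp add: s)
qed

lemma F_nonneg: "0 \<le> x \<Longrightarrow> ereal x < \<rho> \<Longrightarrow> 0 \<le> F x"
  using abs_F_le[of x x] by simp

lemma F_mono: "0 \<le> x \<Longrightarrow> x \<le> y \<Longrightarrow> ereal y < \<rho> \<Longrightarrow> F x \<le> F y"
  using abs_F_le[of x y] by simp

lemma representing_measure:
  assumes "0 \<le> a" "0 \<le> b" "0 \<le> c" "ereal (a + b + c) < \<rho>" "0 < u" "u < 1"
  obtains M where "interval_measure M" "\<And>k. moment M k = F (a * (-1) ^ k + b * u ^ k + c)"
proof -
  obtain M where M: "admissible_measure M" "moment M = (\<lambda>k. F (a * (-1) ^ k + b * u ^ k + c))"
    using preserves[OF assms] unfolding moment_sequences_def by auto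
  have "moment M (2 * k) \<le> F (a + b + c)" for k
  proof -
    have "b * u ^ (2 * k) \<le> b * 1" using assms by (intro mult_left_mono power_le_one) auto
    then have "F (a + b * u ^ (2 * k) + c) \<le> F (a + b + c)"
      using assms by (intro F_mono) auto
    then show ?thesis unfolding M(2) by simp
  qed
  then have "interval_measure M" using interval_measure_if_moments_bounded M(1) by blast
  then show ?thesis using that M(2) by simp
qed

text \<open>Replacing \<open>r\<close> by its \<open>m\<close>-th root refines the sequence: its moments of order \<open>m * k\<close> are the original
ones, the sign of the mass at \<open>-1\<close> being kept because \<open>m\<close> is odd. By determinacy the refined
measure \<open>N\<close> is carried to \<open>M\<close> by \<open>x \<mapsto> x ^ m\<close>, so that the \<open>j\<close>-th moment of \<open>N\<close> becomes an integral
against \<open>M\<close> of the \<open>j\<close>-th power of the real \<open>m\<close>-th root.\<close>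

lemma F_at_odd_root:
  fixes m j :: nat
  assumes abc: "0 \<le> a" "0 \<le> b" "0 \<le> c" "ereal (a + b + c) < \<rho>" and r: "0 < r" "r < 1"
    and M: "interval_measure M" "\<And>k. moment M k = F (a * (-1) ^ k + b * r ^ k + c)"
    and mj: "odd m" "0 < j"
  shows "(\<integral>y. (if 0 \<le> y then 1 else (-1) ^ j) * \<bar>y\<bar> powr (j / m) \<partial>M) =
    F (a * (-1) ^ j + b * r powr (j / m) + c)"
proof -
  have m: "0 < m" using mj(1) by (cases m) auto
  define u where "u = r powr (1 / m)"
  have u: "0 < u" "u < 1" using r m powr_less_mono2[of "1 / m" r 1] by (auto simp: u_def)
  have um: "u ^ m = r" using r m by (simp add: u_def powr_realpow[symmetric] powr_powr)
  have uj: "u ^ j = r powr (j / m)" using r m by (simp add: u_def powr_realpow[symmetric] powr_powr)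
  obtain N where N: "interval_measure N" "\<And>k. moment N k = F (a * (-1) ^ k + b * u ^ k + c)"
    using representing_measure[OF abc u] by blast
  define \<phi> where "\<phi> y = (if 0 \<le> y then 1 else (-1) ^ j) * \<bar>y\<bar> powr (j / m)" for y :: real
  \<comment> \<open>Continuity at \<open>0\<close> is easiest to see when the two half lines are separated.\<close>
  have \<phi>_alt: "\<phi> = (\<lambda>y. (max y 0) powr (j / m) + (-1) ^ j * (max (- y) 0) powr (j / m))"
    by (auto simp: \<phi>_def fun_eq_iff max_def)
  have cont: "continuous_on UNIV \<phi>"
    unfolding \<phi>_alt using mj m by (intro continuous_intros continuous_on_powr') auto
  have \<phi>_pow: "\<phi> (x ^ m) = x ^ j" for x
  proof -
    have *: "\<bar>x ^ m\<bar> powr (j / m) = \<bar>x\<bar> ^ j"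
    proof (cases "x = 0")
      case False
      then show ?thesis using m by (simp add: power_abs powr_realpow[symmetric] powr_powr)
    qed (use mj m in \<open>auto simp: zero_power\<close>)
    show ?thesis
    proof (cases "0 \<le> x")
      case False
      then have "\<not> 0 \<le> x ^ m" using mj(1) by (simp add: zero_le_odd_power)
      moreover have "x ^ j = (-1) ^ j * \<bar>x\<bar> ^ j"
        using False by (simp flip: power_mult_distrib)
      ultimately show ?thesis unfolding \<phi>_def * by simp
    next
      case True
      then show ?thesis unfolding \<phi>_def * by simp
    qed
  qed
  have "moment N (m * k) = moment M k" for k
    using mj(1) by (simp add: N(2) M(2) power_mult um)
  then have "(\<integral>x. \<phi> (x ^ m) \<partial>N) = (\<integral>x. \<phi> x \<partial>M)"
    by (rule integral_eq_if_moments_eq[OF M(1) N(1) _ cont])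
  then have "(\<integral>x. \<phi> x \<partial>M) = moment N j" by (simp add: \<phi>_pow moment_def)
  then show ?thesis by (simp add: \<phi>_def N(2) uj)
qed

section \<open>Power series expansion for positive arguments\<close>

text \<open>For even numerators the sign disappears and \<open>F_at_odd_root\<close> gives the claim for a dense set of
exponents. The right-hand side is continuous in \<open>q\<close> and the left-hand side is monotone, so the two
sides agree for all \<open>q\<close>; continuity of \<open>F\<close> is a consequence.\<close>

lemma F_geometric_eq_integral:
  assumes b: "0 \<le> b" "ereal b < \<rho>" and r: "0 < r" "r < 1"
    and M: "interval_measure M" "\<And>k. moment M k = F (b * r ^ k)" and q: "0 < q"
  shows "F (b * r powr q) = (\<integral>y. \<bar>y\<bar> powr q \<partial>M)"
proof (rule ccontr)
  define J where "J q = (\<integral>y. \<bar>y\<bar> powr q \<partial>M)" for q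
  assume "F (b * r powr q) \<noteq> (\<integral>y. \<bar>y\<bar> powr q \<partial>M)"
  then have e: "0 < \<bar>F (b * r powr q) - J q\<bar>" (is "0 < ?e") by (simp add: J_def)
  let ?J = "\<lambda>z. \<integral>y. complex_of_real 1 * (of_real \<bar>y\<bar> powr z) \<partial>M"
  have J: "complex_of_real (J q) = ?J (of_real q)" for q
    using integral_powr_of_real[where g = "\<lambda>_. 1" and q = q and M = M] by (simp add: J_def)
  have "?J holomorphic_on {z. 0 < Re z}"
    by (rule integral_powr_holomorphic[OF M(1)]) auto
  then have "continuous_on {z. 0 < Re z} ?J" by (rule holomorphic_on_imp_continuous_on)
  then have "continuous_on {0<..} (\<lambda>x. ?J (of_real x))"
    by (rule continuous_on_compose2) (auto intro!: continuous_intros)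
  then have "continuous_on {0<..} (\<lambda>x. Re (?J (of_real x)))" by (rule continuous_on_Re)
  then have "continuous_on {0<..} J" unfolding J[symmetric] by simp
  then have "isCont J q" using q by (simp add: continuous_on_eq_continuous_at)
  then obtain d where d: "0 < d" "\<And>x. \<bar>x - q\<bar> < d \<Longrightarrow> \<bar>J x - J q\<bar> < ?e"
    using e unfolding continuous_at_eps_delta dist_real_def by metis
  have ev: "J (j / m) = F (b * r powr (j / m))" if "odd m" "0 < j" "even j" for j m :: nat
  proof -
    have "(if 0 \<le> y then 1 else (-1) ^ j) = (1 :: real)" for y :: real using that by simp
    then show ?thesis
      using F_at_odd_root[of 0 b 0 r M m j] b r M that(1,2) \<open>even j\<close> by (simp add: J_def)
  qed
  obtain j1 m1 :: nat where 1: "odd m1" "0 < j1" "\<not> odd j1" "max 0 (q - d) < j1 / m1" "j1 / m1 < q"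
    using exists_fraction_with_parity[of "max 0 (q - d)" q False] q d(1) by auto
  obtain j2 m2 :: nat where 2: "odd m2" "0 < j2" "\<not> odd j2" "q < j2 / m2" "j2 / m2 < q + d"
    using exists_fraction_with_parity[of q "q + d" False] q d(1) by auto
  have mono: "F (b * r powr x) \<le> F (b * r powr y)" if "0 < y" "y \<le> x" for x y
  proof (rule F_mono)
    show "b * r powr x \<le> b * r powr y" using that r b by (intro mult_left_mono powr_mono') auto
    have "r powr y \<le> 1" using that r by (simp add: powr_le1)
    then have "b * r powr y \<le> b" using b mult_left_mono by fastforce
    then show "ereal (b * r powr y) < \<rho>" using b(2) by (meson ereal_less_eq(3) le_less_trans)
  qed (use b in auto)
  have "F (b * r powr q) \<le> J (j1 / m1)" using 1 mono[of "j1 / m1" q] ev by simp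
  moreover have "J (j2 / m2) \<le> F (b * r powr q)" using 2 mono[of q "j2 / m2"] ev q by simp
  moreover have "\<bar>J (j1 / m1) - J q\<bar> < ?e" "\<bar>J (j2 / m2) - J q\<bar> < ?e"
    using 1 2 d(2)[of "j1 / m1"] d(2)[of "j2 / m2"] by auto
  ultimately show False by linarith
qed

text \<open>Solve \<open>x = b * (1/2) powr q\<close> for \<open>q\<close>: the holomorphic moment function is composed with a branch of
the logarithm to base \<open>1/2\<close>, which maps the right half of the disc of radius \<open>b\<close> into the right half
plane.\<close>

lemma F_eq_Re_holomorphic:
  assumes b: "0 < b" "ereal b < \<rho>"
  obtains G where "G holomorphic_on {z. 0 < Re z \<and> norm z < b}"
    "\<And>x. 0 < x \<Longrightarrow> x < b \<Longrightarrow> F x = Re (G (of_real x))"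
proof -
  obtain M where M: "interval_measure M" "\<And>k. moment M k = F (0 * (-1) ^ k + b * (1/2) ^ k + 0)"
    using representing_measure[of 0 b 0 "1/2"] b by auto
  let ?J = "\<lambda>z. \<integral>y. complex_of_real 1 * (of_real \<bar>y\<bar> powr z) \<partial>M"
  define l where "l = ln (1/2 :: real)"
  have l: "l < 0" by (simp add: l_def)
  define G where "G z = ?J (Ln (z / of_real b) / of_real l)" for z
  have "G holomorphic_on {z. 0 < Re z \<and> norm z < b}"
  proof -
    let ?g = "\<lambda>z. Ln (z / of_real b) / of_real l"
    have "?J holomorphic_on {z. 0 < Re z}"
      by (rule integral_powr_holomorphic[OF M(1)]) auto
    moreover have nz: "z / complex_of_real b \<notin> \<real>\<^sub>\<le>\<^sub>0" if "0 < Re z" for z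
      using that b by (auto simp: complex_nonpos_Reals_iff field_simps)
    have "?g holomorphic_on {z. 0 < Re z \<and> norm z < b}"
      using l b nz by (intro holomorphic_intros) auto
    moreover have "?g ` {z. 0 < Re z \<and> norm z < b} \<subseteq> {z. 0 < Re z}"
    proof safe
      fix z :: complex assume z: "0 < Re z" "norm z < b"
      then have "z \<noteq> 0" by auto
      then have "Re (?g z) = ln (norm z / b) / l"
        using b by (simp add: norm_divide)
      moreover have "ln (norm z / b) < 0" using z \<open>z \<noteq> 0\<close> b by simp
      ultimately show "0 < Re (?g z)"
        using l by (simp add: divide_neg_neg)
    qed
    ultimately show ?thesis
      unfolding G_def using holomorphic_on_compose_gen[unfolded o_def] by blast
  qed
  moreover have "F x = Re (G (of_real x))" if x: "0 < x" "x < b" for x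
  proof -
    define q where "q = ln (x / b) / l"
    have q: "0 < q" using x b l by (simp add: q_def divide_neg_neg)
    have "(1/2) powr q = x / b"
      using x b l by (simp add: powr_def q_def l_def[symmetric])
    then have "F x = F (b * (1/2) powr q)" using b by simp
    also have "\<dots> = (\<integral>y. \<bar>y\<bar> powr q \<partial>M)"
      using b M q by (intro F_geometric_eq_integral) auto
    also have "\<dots> = Re (G (of_real x))"
      using integral_powr_of_real[where g = "\<lambda>_. 1" and q = q and M = M] x b
      by (simp add: G_def q_def Ln_of_real flip: of_real_divide)
    finally show ?thesis .
  qed
  ultimately show ?thesis using that by blast
qed

lemma higher_deriv_F_eq_Re:
  assumes G: "G holomorphic_on {z. 0 < Re z \<and> norm z < b}"
    and F: "\<And>x. 0 < x \<Longrightarrow> x < b \<Longrightarrow> F x = Re (G (of_real x))"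
    and x: "0 < x" "x < b"
  shows "(deriv ^^ k) F x = Re ((deriv ^^ k) G (of_real x)) \<and>
    ((deriv ^^ k) F has_real_derivative Re ((deriv ^^ Suc k) G (of_real x))) (at x)"
  using x
proof (induction k arbitrary: x)
  let ?S = "{z. 0 < Re z \<and> norm z < b}"
  have S: "open ?S"
    by (intro open_Collect_conj open_Collect_less continuous_intros)
  have step: "(h has_real_derivative Re ((deriv ^^ Suc k) G (of_real x))) (at x)"
    if x: "0 < x" "x < b" and h: "\<And>x. 0 < x \<Longrightarrow> x < b \<Longrightarrow> h x = Re ((deriv ^^ k) G (of_real x))"
    for h x k
  proof -
    have "((deriv ^^ k) G has_field_derivative (deriv ^^ Suc k) G (of_real x)) (at (of_real x))"
      using holomorphic_derivI[OF holomorphic_higher_deriv[OF G S], of "of_real x" k] S x by simp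
    then have "((\<lambda>x. (deriv ^^ k) G (of_real x)) has_vector_derivative (deriv ^^ Suc k) G (of_real x)) (at x)"
      by (rule has_vector_derivative_real_field)
    then have "((\<lambda>x. Re ((deriv ^^ k) G (of_real x))) has_real_derivative Re ((deriv ^^ Suc k) G (of_real x))) (at x)"
      unfolding has_real_derivative_iff_has_vector_derivative
      by (rule bounded_linear.has_vector_derivative[OF bounded_linear_Re])
    then show ?thesis
      by (rule has_field_derivative_transform_within_open[of _ _ _ "{0<..<b}"]) (use x h in auto)
  qed
  {
    case 0
    then show ?case using step[of x F 0] F by simp
  next
    case (Suc k)
    have *: "(deriv ^^ Suc k) F x = Re ((deriv ^^ Suc k) G (of_real x))" if "0 < x" "x < b" for x
      using Suc.IH[OF that] DERIV_imp_deriv by auto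
    show ?case using *[OF Suc.prems] step[OF Suc.prems *] by simp
  }
qed

lemma DERIV_higher_deriv_F:
  assumes "0 < x" "ereal x < \<rho>"
  shows "((deriv ^^ k) F has_real_derivative (deriv ^^ Suc k) F x) (at x)"
proof -
  obtain b where b: "x < b" "ereal b < \<rho>" using ereal_dense2[OF assms(2)] by auto
  then have "0 < b" using assms by simp
  then obtain G where "G holomorphic_on {z. 0 < Re z \<and> norm z < b}"
    "\<And>x. 0 < x \<Longrightarrow> x < b \<Longrightarrow> F x = Re (G (of_real x))"
    using F_eq_Re_holomorphic b by blast
  note * = higher_deriv_F_eq_Re[OF this assms(1) b(1)]
  show ?thesis using *[of k] *[of "Suc k"] by simp
qed

text \<open>Let \<open>s k = c + b * u ^ k\<close> and let \<open>q = p\<^sup>2\<close> where \<open>p\<close> has the roots \<open>1, u, \<dots>, u ^ (n - 1)\<close>. The integral of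
\<open>q\<close> against the representing measure, \<open>\<Sum>i. coeff q i * F (c + b * u ^ i)\<close>, is non-negative. In the Taylor
expansion at \<open>c\<close> the term of order \<open>k\<close> contributes a multiple of \<open>b ^ k * poly q (u ^ k)\<close>, which vanishes
for \<open>k < n\<close>. After division by \<open>b ^ n\<close> the limit \<open>b \<rightarrow> 0\<close> leaves the \<open>n\<close>-th derivative at \<open>c\<close> times the
positive number \<open>poly q (u ^ n)\<close>.\<close>

lemma higher_deriv_F_nonneg:
  assumes c: "0 < c" "ereal c < \<rho>"
  shows "0 \<le> (deriv ^^ n) F c"
proof (cases "n = 0")
  case True
  then show ?thesis using F_nonneg c by simp
next
  case False
  define D where "D k = (deriv ^^ k) F" for k
  define u :: real where "u = 1/2"
  define p where "p = (\<Prod>k<n. [:- (u ^ k), 1:])"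
  define q where "q = p * p"
  have q_root: "poly q (u ^ k) = 0" if "k < n" for k
    using that by (auto simp: q_def p_def poly_prod)
  have q_pos: "0 < poly q (u ^ n)"
  proof -
    have "u ^ n < u ^ k" if "k < n" for k
      using that by (intro power_strict_decreasing) (auto simp: u_def)
    then have "poly p (u ^ n) \<noteq> 0" by (force simp: p_def poly_prod)
    then show ?thesis unfolding q_def poly_mult zero_less_mult_iff by linarith
  qed
  obtain e where e: "c < e" "ereal e < \<rho>" using ereal_dense2[OF c(2)] by auto
  define b where "b m = (e - c) / real (Suc m)" for m
  have b: "0 < b m" "b m \<le> e - c" for m 
  proof -
    show "0 < b m" using e by (simp add: b_def)
    have "(e - c) * 1 \<le> (e - c) * real (Suc m)" using e by (intro mult_left_mono) auto
    then show "b m \<le> e - c" unfolding b_def by (subst pos_divide_le_eq) auto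
  qed
  \<comment> \<open>\<open>t\<close> is an intermediate point for the Lagrange remainder of order \<open>n\<close> at \<open>c + b m * u ^ i\<close>.\<close>
  define rest where "rest m i t \<longleftrightarrow> c < t \<and> t < c + b m \<and>
      F (c + b m * u ^ i) = (\<Sum>k<n. D k c / fact k * (b m * u ^ i) ^ k) + D n t / fact n * (b m * u ^ i) ^ n" for m i t
  have "\<exists>t. rest m i t" for m i
  proof -
    have le: "b m * u ^ i \<le> b m" using b[of m] by (simp add: mult_left_le power_le_one u_def)
    have pos: "0 < b m * u ^ i" using b[of m] by (simp add: u_def)
    have "\<exists>t. c < t \<and> t < c + b m * u ^ i \<and>
      F (c + b m * u ^ i) = (\<Sum>k<n. D k c / fact k * (c + b m * u ^ i - c) ^ k) + D n t / fact n * (c + b m * u ^ i - c) ^ n"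
    proof (rule Taylor_up[where a = c])
      show "0 < n" using False by simp
      show "\<forall>k t. k < n \<and> c \<le> t \<and> t \<le> c + b m * u ^ i \<longrightarrow> DERIV (D k) t :> D (Suc k) t"
      proof safe
        fix k t assume t: "c \<le> t" "t \<le> c + b m * u ^ i"
        have "t \<le> e" using t le b[of m] by linarith
        then have "ereal t < \<rho>" using e(2) by (meson ereal_less_eq(3) le_less_trans)
        then show "DERIV (D k) t :> D (Suc k) t"
          unfolding D_def using t c by (intro DERIV_higher_deriv_F) auto
      qed
    qed (use pos in \<open>auto simp: D_def\<close>)
    then obtain t where "c < t" "t < c + b m * u ^ i"
      "F (c + b m * u ^ i) = (\<Sum>k<n. D k c / fact k * (b m * u ^ i) ^ k) + D n t / fact n * (b m * u ^ i) ^ n"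
      by auto
    then have "rest m i t" using le unfolding rest_def by simp
    then show ?thesis ..
  qed
  then obtain t where rest: "\<And>m i. rest m i (t m i)" by metis
  note t = rest[unfolded rest_def, THEN conjunct1] rest[unfolded rest_def, THEN conjunct2, THEN conjunct1]
    rest[unfolded rest_def, THEN conjunct2, THEN conjunct2]
  have pw: "(b m * u ^ i) ^ k = b m ^ k * (u ^ k) ^ i" for m i k
    unfolding power_mult_distrib power_mult[symmetric] by (simp only: mult.commute)
  have nn: "0 \<le> (\<Sum>i\<le>degree q. coeff q i * (u ^ n) ^ i * D n (t m i))" for m
  proof -
    have "(\<lambda>k. F (0 * (-1) ^ k + b m * u ^ k + c)) \<in> moment_sequences UNIV"
    proof (rule preserves)
      have "0 + b m + c \<le> e" using b[of m] by simp
      then show "ereal (0 + b m + c) < \<rho>" using e(2) by (meson ereal_less_eq(3) le_less_trans)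
    qed (use b[of m] c in \<open>auto simp: u_def\<close>)
    then have "0 \<le> (\<Sum>i\<le>degree q. coeff q i * F (0 * (-1) ^ i + b m * u ^ i + c))"
      unfolding q_def by (rule hankel_form_nonneg)
    also have "\<dots> = (\<Sum>i\<le>degree q. coeff q i * F (c + b m * u ^ i))"
      by (simp add: add.commute)
    also have "\<dots> = (\<Sum>i\<le>degree q. \<Sum>k<n. coeff q i * (D k c / fact k * (b m * u ^ i) ^ k)) +
        (\<Sum>i\<le>degree q. coeff q i * (D n (t m i) / fact n * (b m * u ^ i) ^ n))"
      unfolding t(3) by (simp add: distrib_left sum.distrib sum_distrib_left)
    also have "(\<Sum>i\<le>degree q. \<Sum>k<n. coeff q i * (D k c / fact k * (b m * u ^ i) ^ k)) =
        (\<Sum>k<n. D k c / fact k * b m ^ k * poly q (u ^ k))"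
      unfolding poly_altdef sum_distrib_left
      by (subst sum.swap) (simp add: pw mult_ac)
    also have "\<dots> = 0" using q_root by simp
    also have "(\<Sum>i\<le>degree q. coeff q i * (D n (t m i) / fact n * (b m * u ^ i) ^ n)) =
        b m ^ n / fact n * (\<Sum>i\<le>degree q. coeff q i * (u ^ n) ^ i * D n (t m i))"
      unfolding sum_distrib_left
      by (simp add: pw mult_ac)
    finally have "0 \<le> b m ^ n / fact n * (\<Sum>i\<le>degree q. coeff q i * (u ^ n) ^ i * D n (t m i))"
      by simp
    moreover have "0 < b m ^ n / fact n" using b[of m] by simp
    ultimately show ?thesis using mult_le_cancel_left_pos[of "b m ^ n / fact n" 0] by simp
  qed
  have t_lim: "(\<lambda>m. t m i) \<longlonglongrightarrow> c" for i
  proof -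
    have "(\<lambda>m. c + (e - c) * inverse (real (Suc m))) \<longlonglongrightarrow> c + (e - c) * 0"
      by (intro tendsto_intros LIMSEQ_inverse_real_of_nat)
    then have "(\<lambda>m. c + b m) \<longlonglongrightarrow> c" by (simp add: b_def divide_inverse)
    then show ?thesis
      using t(1,2) by (intro tendsto_sandwich[of "\<lambda>_. c" "\<lambda>m. t m i" sequentially "\<lambda>m. c + b m"]
          always_eventually tendsto_const allI less_imp_le)
  qed
  have "isCont (D n) c"
    using DERIV_higher_deriv_F[OF c] unfolding D_def by (rule DERIV_isCont)
  then have "(\<lambda>m. D n (t m i)) \<longlonglongrightarrow> D n c" for i
    by (rule isCont_tendsto_compose[OF _ t_lim])
  then have "(\<lambda>m. \<Sum>i\<le>degree q. coeff q i * (u ^ n) ^ i * D n (t m i))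
      \<longlonglongrightarrow> (\<Sum>i\<le>degree q. coeff q i * (u ^ n) ^ i * D n c)"
    by (intro tendsto_intros)
  then have "0 \<le> (\<Sum>i\<le>degree q. coeff q i * (u ^ n) ^ i * D n c)"
    by (rule LIMSEQ_le_const) (use nn in auto)
  also have "\<dots> = poly q (u ^ n) * D n c"
    by (simp add: poly_altdef sum_distrib_right)
  finally show ?thesis using q_pos by (simp add: zero_le_mult_iff D_def)
qed

lemma F_power_series:
  obtains a where "\<And>k. 0 \<le> a k" "\<And>x. 0 < x \<Longrightarrow> ereal x < \<rho> \<Longrightarrow> (\<lambda>k. a k * x ^ k) sums F x"
  using power_series_if_derivatives_nonneg[of \<rho> "\<lambda>k. (deriv ^^ k) F", OF \<rho>_pos DERIV_higher_deriv_F higher_deriv_F_nonneg]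
  by auto

section \<open>Continuation to negative arguments\<close>

text \<open>The function \<open>J\<close> of the exponent equals \<open>F (b * r powr q - a)\<close> at all odd fractions \<open>q\<close>, whereas
\<open>f (b * r powr q - a)\<close> is holomorphic in \<open>q\<close> on the right half plane because
\<open>norm (b * r powr q - a) \<le> a + b < \<rho>\<close> there. For small \<open>q\<close> the argument is close to \<open>b - a > y0\<close>, where
\<open>F = f\<close> is known, so the two holomorphic functions agree on a set with a limit point and therefore
at \<open>q = 1\<close>, although \<open>b * r - a\<close> may lie below \<open>y0\<close>.\<close>

lemma F_extends_leftwards:
  assumes f: "f holomorphic_on eball 0 \<rho>"
    and eq: "\<And>y. y0 < y \<Longrightarrow> ereal y < \<rho> \<Longrightarrow> complex_of_real (F y) = f (of_real y)"
    and ab: "0 \<le> a" "0 < b" "ereal (a + b) < \<rho>" "y0 < b - a" and r: "0 < r" "r < 1"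
  shows "complex_of_real (F (b * r - a)) = f (of_real (b * r - a))"
proof -
  obtain M where M: "interval_measure M" "\<And>k. moment M k = F (a * (-1) ^ k + b * r ^ k + 0)"
    using representing_measure[of a b 0 r] ab r by auto
  define g :: "real \<Rightarrow> real" where "g y = (if 0 \<le> y then 1 else -1)" for y
  define J where "J z = (\<integral>y. complex_of_real (g y) * (of_real \<bar>y\<bar> powr z) \<partial>M)" for z
  have J: "J (of_real (j / m)) = of_real (F (b * r powr (j / m) - a))"
    if "odd m" "0 < j" "odd j" for j m :: nat
  proof -
    have "(if 0 \<le> y then 1 else (-1) ^ j) = g y" for y using that(3) by (simp add: g_def)
    then have "(\<integral>y. g y * \<bar>y\<bar> powr (j / m) \<partial>M) = F (b * r powr (j / m) - a)"
      using F_at_odd_root[of a b 0 r M m j] ab r M that(1,2) \<open>odd j\<close> by simp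
    then show ?thesis unfolding J_def integral_powr_of_real by simp
  qed
  have J_hol: "J holomorphic_on {z. 0 < Re z}"
    unfolding J_def by (rule integral_powr_holomorphic[OF M(1)]) (auto simp: g_def)
  define h where "h z = of_real b * exp (z * of_real (ln r)) - complex_of_real a" for z
  have h_real: "h (of_real q) = of_real (b * r powr q - a)" for q
    using r by (simp add: h_def powr_def exp_of_real[symmetric])
  have fh_hol: "(\<lambda>z. f (h z)) holomorphic_on {z. 0 < Re z}"
  proof (rule holomorphic_on_compose_gen[unfolded o_def, OF _ f])
    show "h holomorphic_on {z. 0 < Re z}" unfolding h_def by (intro holomorphic_intros)
    show "h ` {z. 0 < Re z} \<subseteq> eball 0 \<rho>"
    proof safe
      fix z :: complex assume z: "0 < Re z"
      have "norm (h z) \<le> norm (of_real b * exp (z * of_real (ln r))) + norm (complex_of_real a)"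
        unfolding h_def by (rule norm_triangle_ineq4)
      also have "\<dots> = b * exp (Re z * ln r) + a" using ab by (simp add: norm_mult)
      also have "\<dots> \<le> b * 1 + a"
        using z r ab by (intro add_right_mono mult_left_mono) (auto simp: mult_nonneg_nonpos)
      finally have "ereal (norm (h z)) \<le> ereal (a + b)" by simp
      then have "ereal (norm (h z)) < \<rho>" using ab(3) by (rule le_less_trans)
      then show "h z \<in> eball 0 \<rho>" by simp
    qed
  qed
  have "((\<lambda>q. b * exp (q * ln r) - a) \<longlongrightarrow> b * exp (0 * ln r) - a) (at_right 0)"
    by (intro tendsto_intros)
  then have "\<forall>\<^sub>F q in at_right 0. y0 < b * exp (q * ln r) - a"
    using ab(4) by (intro order_tendstoD) auto
  then obtain q1 where q1: "0 < q1" "\<And>q. 0 < q \<Longrightarrow> q < q1 \<Longrightarrow> y0 < b * r powr q - a"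
    unfolding eventually_at_right_field using r by (auto simp: powr_def)
  define U where "U = {complex_of_real (real j / real m) |j m. odd m \<and> 0 < j \<and> odd j \<and> real j / real m < q1}"
  have "J 1 - f (h 1) = 0"
  proof (rule analytic_continuation[where f = "\<lambda>z. J z - f (h z)"])
    show "(\<lambda>z. J z - f (h z)) holomorphic_on {z. 0 < Re z}"
      by (intro holomorphic_intros J_hol fh_hol)
    show "open {z. 0 < Re z}" by (rule open_halfspace_Re_gt)
    show "connected {z. 0 < Re z}" by (intro convex_connected convex_halfspace_Re_gt)
    show "U \<subseteq> {z. 0 < Re z}" by (auto simp: U_def intro!: divide_pos_pos odd_pos)
    show "of_real (q1 / 2) \<in> {z. 0 < Re z}" using q1 by simp
    show "of_real (q1 / 2) islimpt U"
      unfolding islimpt_approachable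
    proof (intro allI impI)
      fix e :: real assume e: "0 < e"
      obtain j m :: nat where jm: "odd m" "0 < j" "odd j" "q1 / 2 < j / m" "j / m < min q1 (q1 / 2 + e)"
        using exists_fraction_with_parity[of "q1 / 2" "min q1 (q1 / 2 + e)" True] q1(1) e by auto
      then have "complex_of_real (j / m) \<in> U" unfolding U_def by auto
      moreover have "complex_of_real (j / m) \<noteq> of_real (q1 / 2)" using jm unfolding of_real_eq_iff by simp
      moreover have "dist (complex_of_real (j / m)) (of_real (q1 / 2)) < e"
        using jm by (simp only: dist_of_real dist_real_def)
      ultimately show "\<exists>x'\<in>U. x' \<noteq> of_real (q1 / 2) \<and> dist x' (of_real (q1 / 2)) < e" by blast
    qed
    show "J z - f (h z) = 0" if zU: "z \<in> U" for z
    proof -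
      obtain j m :: nat where jm: "z = of_real (j / m)" "odd m" "0 < j" "odd j" "j / m < q1"
        using zU unfolding U_def by auto
      have m: "0 < m" using jm(2) by (rule odd_pos)
      have q: "0 < real j / real m" using jm m by simp
      have "r powr (j / m) \<le> 1" using q r by (simp add: powr_le1)
      then have "b * r powr (j / m) \<le> b * 1" using ab by (intro mult_left_mono) auto
      then have "b * r powr (j / m) - a \<le> a + b" using ab by linarith
      then have "ereal (b * r powr (j / m) - a) < \<rho>"
        using ab(3) by (meson ereal_less_eq(3) le_less_trans)
      then show ?thesis
        unfolding jm(1) h_real using J[OF jm(2,3,4)] eq q1(2)[OF q jm(5)] by simp
    qed
  qed simp
  then show ?thesis using J[of 1 1] h_real[of 1] r by simp
qed

text \<open>From \<open>(-n * \<eta>, \<rho>)\<close> one passes to \<open>(-(n + 1) * \<eta>, \<rho>)\<close> with the masses \<open>a = (n + 1) * \<eta>\<close> and \<open>b = 2 * \<eta>\<close>: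
then \<open>b - a\<close> exceeds \<open>-n * \<eta>\<close> by \<open>\<eta>\<close>, while \<open>b * r - a\<close> with \<open>r\<close> in \<open>(0, 1)\<close> covers the new
points. The total mass \<open>a + b\<close> is at most \<open>\<bar>x\<bar> + 3 * \<eta>\<close>, which limits the step size \<open>\<eta>\<close>.\<close>

lemma F_eq_on_symmetric_interval:
  assumes f: "f holomorphic_on eball 0 \<rho>"
    and eq: "\<And>y. 0 < y \<Longrightarrow> ereal y < \<rho> \<Longrightarrow> complex_of_real (F y) = f (of_real y)"
    and x: "ereal \<bar>x\<bar> < \<rho>"
  shows "complex_of_real (F x) = f (of_real x)"
proof -
  obtain R where R: "\<bar>x\<bar> < R" "ereal R < \<rho>" using ereal_dense2[OF x] by auto
  define \<eta> where "\<eta> = (R - \<bar>x\<bar>) / 4"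
  have \<eta>: "0 < \<eta>" "\<bar>x\<bar> + 3 * \<eta> < R" using R by (auto simp: \<eta>_def field_simps)
  have *: "complex_of_real (F y) = f (of_real y)"
    if "- \<bar>x\<bar> \<le> y" "- (real n * \<eta>) < y" "ereal y < \<rho>" for y n
    using that
  proof (induction n arbitrary: y)
    case 0
    then show ?case using eq by simp
  next
    case (Suc n)
    show ?case
    proof (cases "- (real n * \<eta>) < y")
      case True
      then show ?thesis using Suc by simp
    next
      case False
      define a where "a = (real n + 1) * \<eta>"
      have le: "real n * \<eta> \<le> \<bar>x\<bar>" using False Suc.prems(1) by linarith
      have a_eq: "a = real n * \<eta> + \<eta>" by (simp add: a_def algebra_simps)
      have bounds: "0 \<le> a" "a + 2 * \<eta> < R" using \<eta> le by (simp add: a_def) (use \<eta> le in \<open>simp add: a_eq\<close>)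
      define r where "r = (y + a) / (2 * \<eta>)"
      have y: "y = 2 * \<eta> * r - a" using \<eta> by (simp add: r_def)
      have r: "0 < r" "r < 1"
        using \<eta> False Suc.prems(2) by (auto simp: r_def a_eq field_simps)
      have IH: "complex_of_real (F z) = f (of_real z)" if "- (real n * \<eta>) < z" "ereal z < \<rho>" for z
        using Suc.IH[of z] that le by linarith
      have "ereal (a + 2 * \<eta>) < \<rho>"
        using bounds R(2) by (meson ereal_less_eq(3) less_imp_le le_less_trans)
      then show ?thesis
        unfolding y using \<eta> bounds r IH
        by (intro F_extends_leftwards[OF f, of "- (real n * \<eta>)"]) (auto simp: a_eq)
    qed
  qed
  obtain n :: nat where "\<bar>x\<bar> / \<eta> < real n" using reals_Archimedean2 by blast
  then have "\<bar>x\<bar> < real n * \<eta>" using \<eta> by (simp add: field_simps)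
  then show ?thesis
    using x by (intro *[of x n]) (auto intro: le_less_trans[of _ "ereal \<bar>x\<bar>"])
qed

lemma F_absolutely_monotonic:
  obtains f where "absolutely_monotonic_on_disc \<rho> f"
    "\<And>x. ereal \<bar>x\<bar> < \<rho> \<Longrightarrow> complex_of_real (F x) = f (of_real x)"
proof -
  obtain a where a: "\<And>k. 0 \<le> a k" "\<And>x. 0 < x \<Longrightarrow> ereal x < \<rho> \<Longrightarrow> (\<lambda>k. a k * x ^ k) sums F x"
    using F_power_series by blast
  define f where "f z = (\<Sum>k. complex_of_real (a k) * z ^ k)" for z
  have sums: "(\<lambda>k. complex_of_real (a k) * z ^ k) sums f z" if z: "z \<in> eball 0 \<rho>" for z
  proof -
    have "ereal (norm z) < \<rho>" using z by simp
    then obtain K where K: "norm z < K" "ereal K < \<rho>" using ereal_dense2[of "ereal (norm z)" \<rho>] by auto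
    have "0 < K" using K(1) norm_ge_zero[of z] by linarith
    then have "(\<lambda>k. complex_of_real (a k * K ^ k)) sums of_real (F K)"
      using a(2) K(2) by (intro sums_of_real) auto
    then have "summable (\<lambda>k. complex_of_real (a k) * of_real K ^ k)" by (simp add: sums_iff)
    then have "summable (\<lambda>k. complex_of_real (a k) * z ^ k)"
      by (rule powser_inside) (use K \<open>0 < K\<close> in auto)
    then show ?thesis unfolding f_def by (rule summable_sums)
  qed
  have am: "absolutely_monotonic_on_disc \<rho> f"
    using a(1) sums by (rule absolutely_monotonic_on_disc_if_power_series)
  have pos: "complex_of_real (F x) = f (of_real x)" if "0 < x" "ereal x < \<rho>" for x
  proof -
    have "(\<lambda>k. complex_of_real (a k * x ^ k)) sums of_real (F x)"
      using a(2)[OF that] by (rule sums_of_real)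
    moreover have "(\<lambda>k. complex_of_real (a k * x ^ k)) sums f (of_real x)"
      using sums[of "of_real x"] that by simp
    ultimately show ?thesis by (rule sums_unique2)
  qed
  have "f holomorphic_on eball 0 \<rho>" using am by (simp add: absolutely_monotonic_on_disc_def)
  from F_eq_on_symmetric_interval[OF this pos] that am show ?thesis by blast
qed

end

section \<open>Equivalence of the four conditions\<close>

lemma absolutely_monotonic_preserves_moments:
  assumes \<rho>: "0 < \<rho>" and f: "absolutely_monotonic_on_disc \<rho> f"
    and F: "\<And>x. ereal \<bar>x\<bar> < \<rho> \<Longrightarrow> complex_of_real (F x) = f (of_real x)"
    and s: "s \<in> bounded_moment_sequences \<rho> {-1..1}"
  shows "entrywise F s \<in> moment_sequences {-1..1}"
proof -
  obtain a where a: "\<And>k. 0 \<le> a k"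
    "\<And>z. z \<in> eball 0 \<rho> \<Longrightarrow> (\<lambda>k. complex_of_real (a k) * z ^ k) sums f z"
    using absolutely_monotonic_on_disc_power_series[OF f \<rho>] by blast
  have s': "s \<in> moment_sequences {-1..1}" "\<And>k. ereal \<bar>s k\<bar> < \<rho>"
    using s unfolding bounded_moment_sequences_def ereal_in_symmetric_interval_iff by auto
  have "(\<lambda>n. a n * s k ^ n) sums entrywise F s k" for k
  proof -
    have "(\<lambda>n. complex_of_real (a n * s k ^ n)) sums of_real (F (s k))"
      using a(2)[of "of_real (s k)"] s'(2)[of k] F by simp
    then show ?thesis unfolding entrywise_def sums_of_real_iff .
  qed
  then show ?thesis by (rule power_series_preserves_moment_sequences[OF s'(1) a(1)])
qed

lemma moment_sequences_mono: "K \<subseteq> L \<Longrightarrow> moment_sequences K \<subseteq> moment_sequences L"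
  unfolding moment_sequences_def by (auto elim!: eventually_mono)

lemma bounded_moment_sequences_mono:
  "K \<subseteq> L \<Longrightarrow> bounded_moment_sequences \<rho> K \<subseteq> bounded_moment_sequences \<rho> L"
  using moment_sequences_mono unfolding bounded_moment_sequences_def by blast

theorem theorem6p1:
  fixes F :: "real \<Rightarrow> real" and \<rho> :: ereal
  assumes "0 < \<rho>"
  defines "P1 \<equiv> entrywise F ` (\<Union>u\<in>{0<..<1}. bounded_moment_sequences \<rho> {-1, u, 1})
                  \<subseteq> moment_sequences UNIV"
    and "P2 \<equiv> entrywise F ` (\<Union>u\<in>{0<..<1}. bounded_moment_sequences \<rho> {-1, u, 1})
                  \<subseteq> moment_sequences {-1..1}"
    and "P3 \<equiv> entrywise F ` bounded_moment_sequences \<rho> {-1..1} \<subseteq> moment_sequences UNIV"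
    and "P4 \<equiv> \<exists>f. absolutely_monotonic_on_disc \<rho> f \<and>
                  (\<forall>x. ereal x \<in> {-\<rho><..<\<rho>} \<longrightarrow> complex_of_real (F x) = f (complex_of_real x))"
  shows "(P1 \<longleftrightarrow> P2) \<and> (P2 \<longleftrightarrow> P3) \<and> (P3 \<longleftrightarrow> P4)"
proof -
  let ?B = "\<Union>u\<in>{0<..<1}. bounded_moment_sequences \<rho> {-1, u, 1}"
  have B: "?B \<subseteq> bounded_moment_sequences \<rho> {-1..1}"
    by (intro UN_least bounded_moment_sequences_mono) auto
  have UNIV: "moment_sequences {-1..1} \<subseteq> moment_sequences UNIV"
    by (rule moment_sequences_mono) simp
  have "P4" if P1
  proof -
    interpret three_atom_preserver F \<rho>
    proof
      fix a b c u :: real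
      assume *: "0 \<le> a" "0 \<le> b" "0 \<le> c" "ereal (a + b + c) < \<rho>" "0 < u" "u < 1"
      have "entrywise F (\<lambda>k. a * (-1) ^ k + b * u ^ k + c) \<in> moment_sequences UNIV"
        using that three_atoms_in_bounded_moment_sequences[OF *] *(5,6)
        unfolding P1_def image_subset_iff by (meson UN_I greaterThanLessThan_iff)
      then show "(\<lambda>k. F (a * (-1) ^ k + b * u ^ k + c)) \<in> moment_sequences UNIV"
        by (simp add: entrywise_def)
    qed fact
    show P4
      unfolding P4_def ereal_in_symmetric_interval_iff using F_absolutely_monotonic by metis
  qed
  moreover have "entrywise F ` bounded_moment_sequences \<rho> {-1..1} \<subseteq> moment_sequences {-1..1}" if P4
    using that absolutely_monotonic_preserves_moments[OF assms(1)]
    unfolding P4_def ereal_in_symmetric_interval_iff by blast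
  then have "P4 \<longrightarrow> P2 \<and> P3"
    unfolding P2_def P3_def using B UNIV by blast
  moreover have "P2 \<longrightarrow> P1" "P3 \<longrightarrow> P1"
    unfolding P1_def P2_def P3_def using B UNIV by blast+
  ultimately show ?thesis by blast
qed

end
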